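(* Let $K\hat x=\hat y$ and $0<\varepsilon_1<1$. Let $Y_1,Y_2,\dots$ be i.i.d. $\mathcal{Y}$-valued random variables with $\mathbb{E}[Y_1]=\hat y$. Assume there are $q,p$ with $q>p-1>0$ and constants $C_p,C>0$ such that $\sigma_j^2\asymp j^{-q}$, $0<\mathbb{E}(Y_1-\hat y,u_j)^2\le C_pj^{-p}$ and $\mathbb{E}(Y_1-\hat y,u_j)^4\le C\big(\mathbb{E}(Y_1-\hat y,u_j)^2\big)^2$ for all $j\in\mathbb{N}$. Let $0<\varepsilon_2<\min(1,p-1)$, assume $\hat x\in\mathcal{X}_{\nu,\rho}$ with $\nu,\rho>0$, and let $k_n$ be the stopping index of the modified discrepancy principle (defined in the context) computed from $Y_1,\dots,Y_n$ with parameters $\varepsilon_1,\varepsilon_2$. Then there is $L>0$ such that $$\lim_{n\to\infty}\mathbb{P}\left(\|\bar X^n_{k_n}-\hat x\|\le L\max\left(\rho^{\frac{q+1+\varepsilon_2-p}{(\nu+1)q+1+\varepsilon_2-p}}\left(\frac{1}{\sqrt n}\right)^{\frac{\nu}{\nu+1-\frac{p-1-\varepsilon_2}{q}}},\ \rho\left(\frac{1}{\sqrt n}\right)^{(1-\varepsilon_1)q\nu}\right)\right)=1.$$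
   Context: $\mathcal{X},\mathcal{Y}$ are infinite-dimensional real separable Hilbert spaces and $K:\mathcal{X}\to\mathcal{Y}$ is a compact linear operator with dense range, with singular value decomposition $(\sigma_j,u_j,v_j)_{j\in\mathbb{N}}$: $(u_j)$ is an orthonormal basis of $\mathcal{Y}$, $(v_j)$ an orthonormal basis of $\mathcal{N}(K)^\perp$, $(\sigma_j)$ is a nonincreasing sequence of positive numbers converging to $0$, and $Kv_j=\sigma_ju_j$. For $\nu,\rho>0$, $\mathcal{X}_{\nu,\rho}:=\{\sum_j\sigma_j^\nu(\xi,v_j)v_j:\xi\in\mathcal{X},\|\xi\|\le\rho\}$. $\bar Y_n:=\frac1n\sum_{i=1}^nY_i$ and $\bar X^n_k:=\sum_{j=1}^k\sigma_j^{-1}(\bar Y_n,u_j)v_j$ (with $\bar X^n_0=0$). $a_j\asymp b_j$ means two-sided bounds with constants independent of $j$. Modified discrepancy principle (Algorithm 1), with parameters $\varepsilon_1,\varepsilon_2$: set $m_n:=\lfloor n^{1-\varepsilon_1}\rfloor$; for $j=1,\dots,m_n$ let $s_{j,n}^2:=\frac{1}{n-1}\sum_{i=1}^n(Y_i-\bar Y_n,u_j)^2$ and $S_n:=\sum_{j'=1}^{m_n}s_{j',n}^2$; define weights $d_{1,n}:=\sqrt{\min(S_n/s_{1,n}^2,\ 1/\sigma_1^2)}$ and, for $j=2,\dots,m_n$, $d_{j,n}:=\sqrt{\min\big(j^{-(1+\varepsilon_2)}S_n/s_{j,n}^2,\ \sigma_{j-1}^2d_{j-1,n}^2/\sigma_j^2\big)}$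 (a quotient with zero denominator is read as $+\infty$); set $\delta_n':=\sqrt{\frac1n\sum_{j=1}^{m_n}d_{j,n}^2s_{j,n}^2}$; and let $k_n:=\min\{k\in\{0,\dots,m_n\}:\ \sqrt{\sum_{j=k+1}^{m_n}d_{j,n}^2(\bar Y_n,u_j)^2}\le\delta_n'\}$ (empty sums are $0$). *)

theory Defs
  imports "HOL-Analysis.Analysis" "HOL-Probability.Probability"
begin

definition compact_operator :: "('a::real_normed_vector \<Rightarrow> 'b::real_normed_vector) \<Rightarrow> bool" where
  "compact_operator K \<longleftrightarrow> linear K \<and> compact (closure (K ` ball 0 1))"

definition is_svd :: "('a::real_inner \<Rightarrow> 'b::real_inner) \<Rightarrow> (nat \<Rightarrow> real) \<Rightarrow> (nat \<Rightarrow> 'b) \<Rightarrow> (nat \<Rightarrow> 'a) \<Rightarrow> bool" where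
  "is_svd K \<sigma> u v \<longleftrightarrow>
     (\<forall>i\<ge>1. \<forall>j\<ge>1. inner (u i) (u j) = (if i = j then 1 else 0)) \<and>
     closure (span (u ` {1..})) = UNIV \<and>
     (\<forall>i\<ge>1. \<forall>j\<ge>1. inner (v i) (v j) = (if i = j then 1 else 0)) \<and>
     closure (span (v ` {1..})) = {x. \<forall>z. K z = 0 \<longrightarrow> inner x z = 0} \<and>
     (\<forall>j\<ge>1. \<sigma> j > 0) \<and> (\<forall>j\<ge>1. \<sigma> (Suc j) \<le> \<sigma> j) \<and> \<sigma> \<longlonglongrightarrow> 0 \<and>
     (\<forall>j\<ge>1. K (v j) = \<sigma> j *\<^sub>R u j)"

definition source_set :: "(nat \<Rightarrow> real) \<Rightarrow> (nat \<Rightarrow> 'a::real_inner) \<Rightarrow> real \<Rightarrow> real \<Rightarrow> 'a set" where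
  "source_set \<sigma> v \<nu> \<rho> = {x. \<exists>\<xi>. norm \<xi> \<le> \<rho> \<and>
      ((\<lambda>j. (\<sigma> j powr \<nu> * inner \<xi> (v j)) *\<^sub>R v j) has_sum x) {1..}}"

definition Ybar :: "nat \<Rightarrow> (nat \<Rightarrow> 'b::real_normed_vector) \<Rightarrow> 'b" where
  "Ybar n y = (1 / real n) *\<^sub>R (\<Sum>i=1..n. y i)"

definition Xbar :: "(nat \<Rightarrow> real) \<Rightarrow> (nat \<Rightarrow> 'b::real_inner) \<Rightarrow> (nat \<Rightarrow> 'a::real_inner)
    \<Rightarrow> nat \<Rightarrow> (nat \<Rightarrow> 'b) \<Rightarrow> nat \<Rightarrow> 'a" where
  "Xbar \<sigma> u v n y k = (\<Sum>j=1..k. (inner (Ybar n y) (u j) / \<sigma> j) *\<^sub>R v j)"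

definition mdp_m :: "real \<Rightarrow> nat \<Rightarrow> nat" where
  "mdp_m \<epsilon>1 n = nat \<lfloor>real n powr (1 - \<epsilon>1)\<rfloor>"

definition mdp_s2 :: "(nat \<Rightarrow> 'b::real_inner) \<Rightarrow> nat \<Rightarrow> (nat \<Rightarrow> 'b) \<Rightarrow> nat \<Rightarrow> real" where
  "mdp_s2 u n y j = 1 / (real n - 1) * (\<Sum>i=1..n. (inner (y i - Ybar n y) (u j))\<^sup>2)"

definition mdp_S :: "real \<Rightarrow> (nat \<Rightarrow> 'b::real_inner) \<Rightarrow> nat \<Rightarrow> (nat \<Rightarrow> 'b) \<Rightarrow> real" where
  "mdp_S \<epsilon>1 u n y = (\<Sum>j'=1..mdp_m \<epsilon>1 n. mdp_s2 u n y j')"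

text \<open>Squared weights d_{j,n}^2, with s2 the empirical variances and S their sum;
  a quotient with zero denominator is +infinity, so it drops out of the minimum.\<close>
fun mdp_dsq :: "(nat \<Rightarrow> real) \<Rightarrow> real \<Rightarrow> (nat \<Rightarrow> real) \<Rightarrow> real \<Rightarrow> nat \<Rightarrow> real" where
  "mdp_dsq \<sigma> \<epsilon>2 s2 S 0 = 0"
| "mdp_dsq \<sigma> \<epsilon>2 s2 S (Suc j) =
     (if j = 0 then
        (if s2 1 = 0 then 1 / (\<sigma> 1)\<^sup>2 else min (S / s2 1) (1 / (\<sigma> 1)\<^sup>2))
      else
        (let c = (\<sigma> j)\<^sup>2 * mdp_dsq \<sigma> \<epsilon>2 s2 S j / (\<sigma> (Suc j))\<^sup>2 in
         if s2 (Suc j) = 0 then c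
         else min (real (Suc j) powr (-(1 + \<epsilon>2)) * S / s2 (Suc j)) c))"

definition mdp_d :: "real \<Rightarrow> real \<Rightarrow> (nat \<Rightarrow> real) \<Rightarrow> (nat \<Rightarrow> 'b::real_inner) \<Rightarrow> nat \<Rightarrow> (nat \<Rightarrow> 'b) \<Rightarrow> nat \<Rightarrow> real" where
  "mdp_d \<epsilon>1 \<epsilon>2 \<sigma> u n y j = sqrt (mdp_dsq \<sigma> \<epsilon>2 (mdp_s2 u n y) (mdp_S \<epsilon>1 u n y) j)"

definition mdp_delta :: "real \<Rightarrow> real \<Rightarrow> (nat \<Rightarrow> real) \<Rightarrow> (nat \<Rightarrow> 'b::real_inner) \<Rightarrow> nat \<Rightarrow> (nat \<Rightarrow> 'b) \<Rightarrow> real" where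
  "mdp_delta \<epsilon>1 \<epsilon>2 \<sigma> u n y =
     sqrt (1 / real n * (\<Sum>j=1..mdp_m \<epsilon>1 n. (mdp_d \<epsilon>1 \<epsilon>2 \<sigma> u n y j)\<^sup>2 * mdp_s2 u n y j))"

definition mdp_k :: "real \<Rightarrow> real \<Rightarrow> (nat \<Rightarrow> real) \<Rightarrow> (nat \<Rightarrow> 'b::real_inner) \<Rightarrow> nat \<Rightarrow> (nat \<Rightarrow> 'b) \<Rightarrow> nat" where
  "mdp_k \<epsilon>1 \<epsilon>2 \<sigma> u n y =
     (LEAST k. k \<le> mdp_m \<epsilon>1 n \<and>
        sqrt (\<Sum>j=k+1..mdp_m \<epsilon>1 n. (mdp_d \<epsilon>1 \<epsilon>2 \<sigma> u n y j)\<^sup>2 * (inner (Ybar n y) (u j))\<^sup>2)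
          \<le> mdp_delta \<epsilon>1 \<epsilon>2 \<sigma> u n y)"

end

theory Submission
  imports Defs "HOL-Real_Asymp.Real_Asymp"
begin

text \<open>
  Write \<open>a\<^sub>j\<close> for the variance of \<open>(Y\<^sub>1, u\<^sub>j)\<close>, \<open>e\<^sub>j = (Ybar\<^sub>n - yhat, u\<^sub>j)\<close>, \<open>x\<^sub>j = (xhat, v\<^sub>j)\<close>, \<open>D\<^sub>j\<close> for the squared weights,
  and \<open>\<theta> = q + 1 + \<epsilon>\<^sub>2 - p\<close>, \<open>\<beta> = q \<nu>\<close>, \<open>\<alpha> = \<beta> / (\<beta> + \<theta>)\<close>; the squared rate is \<open>n\<^bsup>-\<alpha>\<^esup>\<close>.
  Chebyshev's inequality and \<open>m\<^sub>n / n \<rightarrow> 0\<close> show that, with probability tending to one, all empirical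
  variances with \<open>j \<le> m\<^sub>n\<close> are within constant factors of \<open>a\<^sub>j\<close>. Then \<open>\<sigma>\<^sub>j\<^sup>2 D\<^sub>j\<close> is nonincreasing in \<open>j\<close>
  and at least a multiple of \<open>j\<^bsup>-\<theta>\<^esup>\<close>, \<open>D\<^sub>j\<close> is at most a multiple of \<open>j\<^bsup>-(1+\<epsilon>\<^sub>2)\<^esup> / a\<^sub>j\<close>, and the squared
  noise level \<open>\<delta>'\<^sub>n\<^sup>2\<close> is of exact order \<open>1 / n\<close>.

  The weighted noise \<open>\<Sum> D\<^sub>j e\<^sub>j\<^sup>2\<close> is of order \<open>1 / n\<close> only in expectation, so it cannot be compared with
  \<open>\<delta>'\<^sub>n\<^sup>2\<close> with probability tending to one. Hence one splits at \<open>J\<^sub>n = \<lfloor>n\<^bsup>\<tau>\<^esup>\<rfloor>\<close> with small \<open>\<tau> > 0\<close>: beyond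
  \<open>J\<^sub>n\<close> the expectation is \<open>o(1 / n)\<close>, and up to \<open>J\<^sub>n\<close> even the unweighted noise \<open>\<Sum> e\<^sub>j\<^sup>2 / \<sigma>\<^sub>j\<^sup>2\<close> is
  \<open>o(n\<^bsup>-\<alpha>\<^esup>)\<close>, because \<open>\<alpha> < 1\<close>; Markov's inequality suffices for both. The remaining argument is
  deterministic: failure of the residual test at \<open>k\<^sub>n - 1\<close> bounds the propagated noise, success at \<open>k\<^sub>n\<close>
  bounds \<open>\<Sum> \<sigma>\<^sub>j\<^sup>2 D\<^sub>j x\<^sub>j\<^sup>2\<close> beyond \<open>k\<^sub>n\<close>, and interpolation with the source condition bounds the bias.
\<close>

subsection \<open>Moments and sample variances\<close>

text \<open>A summand that is split off is independent of the sum of the others, so the cross term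
  of the square is integrable and has mean zero.\<close>

lemma (in prob_space) second_moment_sum_indep:
  fixes Z :: "'i \<Rightarrow> 'a \<Rightarrow> real"
  assumes "finite I" "indep_vars (\<lambda>_. borel) Z I"
    and "\<And>i. i \<in> I \<Longrightarrow> integrable M (\<lambda>\<omega>. (Z i \<omega>)\<^sup>2)"
    and "\<And>i. i \<in> I \<Longrightarrow> expectation (Z i) = 0"
  shows "integrable M (\<lambda>\<omega>. (\<Sum>i\<in>I. Z i \<omega>)\<^sup>2)
    \<and> expectation (\<lambda>\<omega>. (\<Sum>i\<in>I. Z i \<omega>)\<^sup>2) = (\<Sum>i\<in>I. expectation (\<lambda>\<omega>. (Z i \<omega>)\<^sup>2))"
  using assms
proof (induction I rule: finite_induct)
  case empty
  then show ?case by simp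
next
  case (insert i I)
  let ?S = "\<lambda>\<omega>. \<Sum>i\<in>I. Z i \<omega>"
  have indep: "indep_vars (\<lambda>_. borel) Z I"
    by (rule indep_vars_subset[OF insert.prems(1)]) auto
  have IH: "integrable M (\<lambda>\<omega>. (?S \<omega>)\<^sup>2)"
    "expectation (\<lambda>\<omega>. (?S \<omega>)\<^sup>2) = (\<Sum>i\<in>I. expectation (\<lambda>\<omega>. (Z i \<omega>)\<^sup>2))"
    using insert.IH[OF indep] insert.prems by auto
  have meas: "Z j \<in> borel_measurable M" if "j \<in> insert i I" for j
    using insert.prems(1) that by (auto simp: indep_vars_def)
  have int: "integrable M (Z j)" if "j \<in> insert i I" for j
    using square_integrable_imp_integrable meas insert.prems(2) that by blast
  have iS: "integrable M ?S" using int by auto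
  have iv: "indep_var borel (Z i) borel ?S"
    by (rule indep_vars_sum) (use insert in auto)
  have prod: "integrable M (\<lambda>\<omega>. Z i \<omega> * ?S \<omega>)"
    by (rule indep_var_integrable[OF iv]) (use int iS in auto)
  have "expectation (\<lambda>\<omega>. Z i \<omega> * ?S \<omega>) = expectation (Z i) * expectation ?S"
    by (rule indep_var_lebesgue_integral[OF iv]) (use int iS in auto)
  then have prod0: "expectation (\<lambda>\<omega>. Z i \<omega> * ?S \<omega>) = 0"
    using insert.prems(3) by simp
  have expand: "(\<Sum>j\<in>insert i I. Z j \<omega>)\<^sup>2 = (Z i \<omega>)\<^sup>2 + 2 * (Z i \<omega> * ?S \<omega>) + (?S \<omega>)\<^sup>2" for \<omega>
    using insert.hyps by (simp add: power2_eq_square algebra_simps)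
  show ?case
    unfolding expand using insert.hyps insert.prems(2) prod prod0 IH by simp
qed

lemma (in prob_space) markov_prob:
  fixes Z :: "'a \<Rightarrow> real"
  assumes "integrable M Z" "\<And>\<omega>. 0 \<le> Z \<omega>" "expectation Z \<le> B" "0 < c"
  shows "prob {\<omega> \<in> space M. c < Z \<omega>} \<le> B / c"
proof -
  have [measurable]: "Z \<in> borel_measurable M" using assms(1) by auto
  have "prob {\<omega> \<in> space M. c < Z \<omega>} \<le> prob {\<omega> \<in> space M. c \<le> Z \<omega>}"
    by (rule finite_measure_mono) auto
  also have "\<dots> \<le> expectation Z / c"
    using assms by (intro integral_Markov_inequality_measure[where A = "{}"]) auto
  also have "\<dots> \<le> B / c" using assms by (simp add: divide_right_mono)
  finally show ?thesis .
qed

lemma sum_sq_dev_mean: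
  fixes w :: "nat \<Rightarrow> real"
  assumes "n \<ge> 1"
  shows "(\<Sum>i=1..n. (w i - (\<Sum>i=1..n. w i) / n)\<^sup>2) = (\<Sum>i=1..n. (w i)\<^sup>2) - (\<Sum>i=1..n. w i)\<^sup>2 / n"
proof -
  define s where "s = (\<Sum>i=1..n. w i)"
  have "(\<Sum>i=1..n. (w i - s / n)\<^sup>2) = (\<Sum>i=1..n. (w i)\<^sup>2) - 2 * (s / n) * s + n * (s / n)\<^sup>2"
    unfolding s_def
    by (simp add: power2_diff sum.distrib sum_subtractf flip: sum_distrib_left sum_distrib_right
        sum_divide_distrib)
  also have "\<dots> = (\<Sum>i=1..n. (w i)\<^sup>2) - s\<^sup>2 / n"
    using assms by (simp add: power2_eq_square field_simps)
  finally show ?thesis unfolding s_def .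
qed

text \<open>With \<open>Q\<close> the sum of squares and \<open>s\<close> the plain sum,
  \<open>v * (real n - 1) = Q - s\<^sup>2 / n\<close> lies between 5/8 and 5/4 of
  \<open>n * a\<close>. The constants 1/2 and 3 leave room for the normalisation by
  \<open>n - 1\<close>, which costs at most a factor 2 since \<open>n \<ge> 2\<close>.\<close>

lemma sample_variance_between:
  fixes w :: "nat \<Rightarrow> real"
  assumes "n \<ge> 2" "a > 0"
    and "(\<Sum>i=1..n. (w i)\<^sup>2 - a)\<^sup>2 \<le> (n * a / 4)\<^sup>2"
    and "(\<Sum>i=1..n. w i)\<^sup>2 \<le> n\<^sup>2 * a / 8"
  defines "v \<equiv> 1 / (real n - 1) * (\<Sum>i=1..n. (w i - (\<Sum>i=1..n. w i) / n)\<^sup>2)"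
  shows "a / 2 \<le> v \<and> v \<le> 3 * a"
proof -
  define Q where "Q = (\<Sum>i=1..n. (w i)\<^sup>2)"
  define s where "s = (\<Sum>i=1..n. w i)"
  have n: "real n \<ge> 2" using assms(1) by simp
  have "\<bar>Q - n * a\<bar> \<le> n * a / 4"
    using assms(3) abs_le_square_iff[of "Q - n * a" "n * a / 4"] \<open>a > 0\<close>
    by (simp add: Q_def sum_subtractf)
  then have Q: "3 / 4 * (n * a) \<le> Q" "Q \<le> 5 / 4 * (n * a)" by linarith+
  have s: "0 \<le> s\<^sup>2 / n" "s\<^sup>2 / n \<le> n * a / 8"
    using assms(4) n by (auto simp: s_def field_simps power2_eq_square)
  have v: "v * (real n - 1) = Q - s\<^sup>2 / n"
    unfolding v_def using sum_sq_dev_mean[of n w] n by (simp add: Q_def s_def)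
  have "a / 2 * (real n - 1) \<le> v * (real n - 1)"
  proof -
    have "a / 2 * (real n - 1) = 1 / 2 * (n * a) - a / 2" by (simp add: field_simps)
    moreover have "0 \<le> n * a" using \<open>a > 0\<close> by simp
    ultimately show ?thesis unfolding v using Q(1) s(2) \<open>a > 0\<close> by linarith
  qed
  moreover have "v * (real n - 1) \<le> 3 * a * (real n - 1)"
  proof -
    have "2 * a \<le> n * a" using n \<open>a > 0\<close> by (intro mult_right_mono) auto
    moreover have "3 * a * (real n - 1) = 3 * (n * a) - 3 * a" by (simp add: field_simps)
    ultimately show ?thesis unfolding v using Q(2) s(1) \<open>a > 0\<close> by linarith
  qed
  ultimately show ?thesis using n by simp
qed

text \<open>Chebyshev's inequality is applied to the centred squares, whose second moments are
  controlled by the fourth moments, and to the plain sum. Both thresholds scale with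
  \<open>a\<close>, so the resulting bound is free of \<open>a\<close>; this is what allows a union
  bound over many components with decaying variances.\<close>

lemma (in prob_space) sample_variance_concentration:
  fixes W :: "nat \<Rightarrow> 'a \<Rightarrow> real"
  assumes n: "n \<ge> 2" and a: "a > 0" and indep: "indep_vars (\<lambda>_. borel) W {1..n}"
    and int2: "\<And>i. i \<in> {1..n} \<Longrightarrow> integrable M (\<lambda>\<omega>. (W i \<omega>)^2)"
    and int4: "\<And>i. i \<in> {1..n} \<Longrightarrow> integrable M (\<lambda>\<omega>. (W i \<omega>)^4)"
    and mean: "\<And>i. i \<in> {1..n} \<Longrightarrow> expectation (W i) = 0"
    and var: "\<And>i. i \<in> {1..n} \<Longrightarrow> expectation (\<lambda>\<omega>. (W i \<omega>)^2) = a"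
    and mom4: "\<And>i. i \<in> {1..n} \<Longrightarrow> expectation (\<lambda>\<omega>. (W i \<omega>)^4) \<le> C * a\<^sup>2"
  defines "v \<equiv> \<lambda>\<omega>. 1 / (real n - 1) * (\<Sum>i=1..n. (W i \<omega> - (\<Sum>i=1..n. W i \<omega>) / n)\<^sup>2)"
  shows "prob {\<omega> \<in> space M. \<not> (a / 2 \<le> v \<omega> \<and> v \<omega> \<le> 3 * a)} \<le> (16 * C + 8) / n"
proof -
  have [measurable]: "W i \<in> borel_measurable M" if "i \<in> {1..n}" for i
    using indep that by (auto simp: indep_vars_def)
  let ?V = "\<lambda>i \<omega>. (W i \<omega>)\<^sup>2 - a"
  have indepV: "indep_vars (\<lambda>_. borel) ?V {1..n}"
    by (rule indep_vars_compose2[OF indep]) auto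
  have Vsq: "(?V i \<omega>)\<^sup>2 = (W i \<omega>)^4 - 2 * a * (W i \<omega>)^2 + a\<^sup>2" for i \<omega>
    by (simp add: power2_eq_square power4_eq_xxxx algebra_simps)
  have V: "integrable M (\<lambda>\<omega>. (?V i \<omega>)\<^sup>2)" "expectation (?V i) = 0"
    and EVsq: "expectation (\<lambda>\<omega>. (?V i \<omega>)\<^sup>2) = expectation (\<lambda>\<omega>. (W i \<omega>)^4) - 2 * a * a + a\<^sup>2"
    if "i \<in> {1..n}" for i
    unfolding Vsq using int2[OF that] int4[OF that] var[OF that] prob_space by auto
  have EVsq_le: "expectation (\<lambda>\<omega>. (?V i \<omega>)\<^sup>2) \<le> C * a\<^sup>2" if "i \<in> {1..n}" for i
    using EVsq[OF that] mom4[OF that] zero_le_power2[of a] unfolding power2_eq_square by linarith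
  define A1 where "A1 = {\<omega> \<in> space M. (n * a / 4)\<^sup>2 < (\<Sum>i=1..n. ?V i \<omega>)\<^sup>2}"
  define A2 where "A2 = {\<omega> \<in> space M. n\<^sup>2 * a / 8 < (\<Sum>i=1..n. W i \<omega>)\<^sup>2}"
  have [measurable]: "A1 \<in> sets M" "A2 \<in> sets M" unfolding A1_def A2_def by measurable
  have "(\<Sum>i=1..n. expectation (\<lambda>\<omega>. (?V i \<omega>)\<^sup>2)) \<le> (\<Sum>i=1..n. C * a\<^sup>2)"
    using EVsq_le by (intro sum_mono) auto
  then have "prob A1 \<le> (n * (C * a\<^sup>2)) / (n * a / 4)\<^sup>2"
    unfolding A1_def using second_moment_sum_indep[OF _ indepV V] n a
    by (intro markov_prob) auto
  also have "\<dots> = 16 * C / n" using n a by (simp add: power2_eq_square)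
  finally have 1: "prob A1 \<le> 16 * C / n" .
  have "prob A2 \<le> (n * a) / (n\<^sup>2 * a / 8)"
    unfolding A2_def using second_moment_sum_indep[OF _ indep int2 mean] n a var
    by (intro markov_prob) auto
  also have "\<dots> = 8 / n" using n a by (simp add: power2_eq_square)
  finally have 2: "prob A2 \<le> 8 / n" .
  have "{\<omega> \<in> space M. \<not> (a / 2 \<le> v \<omega> \<and> v \<omega> \<le> 3 * a)} \<subseteq> A1 \<union> A2"
  proof (rule subsetI, rule ccontr)
    fix \<omega> assume \<omega>: "\<omega> \<in> {\<omega> \<in> space M. \<not> (a / 2 \<le> v \<omega> \<and> v \<omega> \<le> 3 * a)}" "\<omega> \<notin> A1 \<union> A2"
    then have "a / 2 \<le> v \<omega> \<and> v \<omega> \<le> 3 * a"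
      unfolding v_def by (intro sample_variance_between[OF n a]) (auto simp: A1_def A2_def)
    with \<omega> show False by simp
  qed
  then have "prob {\<omega> \<in> space M. \<not> (a / 2 \<le> v \<omega> \<and> v \<omega> \<le> 3 * a)} \<le> prob (A1 \<union> A2)"
    by (intro finite_measure_mono) auto
  also have "\<dots> \<le> prob A1 + prob A2" by (intro measure_Un_le) auto
  also have "\<dots> \<le> (16 * C + 8) / n" using 1 2 by (simp add: add_divide_distrib)
  finally show ?thesis .
qed

subsection \<open>Orthonormal expansions\<close>

text \<open>The image of the unit ball lies in a compact, hence bounded set. The ball is open, so a
  vector is scaled to norm 1/2, which explains the factor 2.\<close>

lemma bounded_linear_compact_operator:
  assumes "compact_operator K"
  shows "bounded_linear K"
proof -
  have lin: "linear K" and "bounded (closure (K ` ball 0 1))"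
    using assms by (auto simp: compact_operator_def compact_imp_bounded)
  then have "bounded (K ` ball 0 1)" by (meson bounded_subset closure_subset)
  then obtain B where "\<forall>z\<in>ball 0 1. norm (K z) \<le> B"
    by (auto simp: bounded_iff)
  then have B: "norm (K z) \<le> B" if "norm z < 1" for z
    using that by simp
  interpret linear K by (rule lin)
  show ?thesis
  proof (rule bounded_linear_intro)
    fix z
    show "norm (K z) \<le> norm z * (2 * B)"
    proof (cases "z = 0")
      case False
      have "norm (K ((1 / (2 * norm z)) *\<^sub>R z)) \<le> B" using False by (intro B) simp
      then show ?thesis using False by (simp add: scale field_simps)
    qed (simp add: zero)
  qed (simp_all add: add scale)
qed

lemma has_sum_from_1_partial_sums:
  fixes f :: "nat \<Rightarrow> 'a::{topological_comm_monoid_add, t2_space}"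
  assumes "(f has_sum s) {1..}"
  shows "(\<lambda>N. \<Sum>j=1..N. f j) \<longlonglongrightarrow> s"
proof -
  have "((\<lambda>j. if j \<ge> 1 then f j else 0) has_sum s) UNIV"
    using assms by (subst has_sum_cong_neutral[where g = f and T = "{1..}"]) auto
  then have "(\<lambda>j. if j \<ge> 1 then f j else 0) sums s" by (rule has_sum_imp_sums)
  then have "(\<lambda>N. \<Sum>j\<le>N. if j \<ge> 1 then f j else 0) \<longlonglongrightarrow> s" by (simp add: sums_def_le)
  moreover have "(\<Sum>j\<le>N. if j \<ge> 1 then f j else 0) = (\<Sum>j=1..N. f j)" for N
    by (rule sum.mono_neutral_cong_right) auto
  ultimately show ?thesis by simp
qed

lemma norm_sum_orthonormal:
  fixes v :: "'i \<Rightarrow> 'a::real_inner"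
  assumes "finite F" "\<And>i j. i \<in> F \<Longrightarrow> j \<in> F \<Longrightarrow> inner (v i) (v j) = (if i = j then 1 else 0)"
  shows "(norm (\<Sum>j\<in>F. b j *\<^sub>R v j))\<^sup>2 = (\<Sum>j\<in>F. (b j)\<^sup>2)"
proof -
  have "(norm (\<Sum>j\<in>F. b j *\<^sub>R v j))\<^sup>2 = (\<Sum>i\<in>F. \<Sum>j\<in>F. b i * (b j * inner (v j) (v i)))"
    by (simp add: power2_norm_eq_inner inner_sum_left inner_sum_right sum_distrib_left)
  also have "\<dots> = (\<Sum>i\<in>F. \<Sum>j\<in>F. if j = i then (b i)\<^sup>2 else 0)"
    using assms(2) by (intro sum.cong refl) (auto simp: power2_eq_square)
  also have "\<dots> = (\<Sum>j\<in>F. (b j)\<^sup>2)" using assms(1) by simp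
  finally show ?thesis .
qed

lemma bessel_inequality:
  fixes v :: "'i \<Rightarrow> 'a::real_inner"
  assumes "finite F" "\<And>i j. i \<in> F \<Longrightarrow> j \<in> F \<Longrightarrow> inner (v i) (v j) = (if i = j then 1 else 0)"
  shows "(\<Sum>j\<in>F. (inner z (v j))\<^sup>2) \<le> (norm z)\<^sup>2"
proof -
  let ?p = "\<Sum>j\<in>F. inner z (v j) *\<^sub>R v j"
  have "inner z ?p = (\<Sum>j\<in>F. (inner z (v j))\<^sup>2)"
    by (simp add: inner_sum_right power2_eq_square)
  moreover have "inner ?p ?p = (\<Sum>j\<in>F. (inner z (v j))\<^sup>2)"
    using norm_sum_orthonormal[OF assms] by (simp add: power2_norm_eq_inner)
  moreover have "0 \<le> inner (z - ?p) (z - ?p)" by simp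
  ultimately show ?thesis
    by (simp add: power2_norm_eq_inner inner_diff_left inner_diff_right inner_commute)
qed

text \<open>By continuity the coefficient is a limit over partial sums, and these coefficients are
  constant from \<open>N = j\<close> on.\<close>

lemma inner_svd_image:
  fixes K :: "'a::real_inner \<Rightarrow> 'b::real_inner"
  assumes "bounded_linear K" and svd: "is_svd K \<sigma> u v"
    and x_sum: "((\<lambda>j. a j *\<^sub>R v j) has_sum x) {1..}" and j: "j \<ge> 1"
  shows "inner (K x) (u j) = \<sigma> j * a j"
proof -
  interpret bounded_linear K by fact
  have lim: "(\<lambda>N. inner (K (\<Sum>i=1..N. a i *\<^sub>R v i)) (u j)) \<longlonglongrightarrow> inner (K x) (u j)"
    using has_sum_from_1_partial_sums[OF x_sum] by (intro tendsto_inner tendsto) auto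
  have ev: "\<forall>\<^sub>F N in sequentially. inner (K (\<Sum>i=1..N. a i *\<^sub>R v i)) (u j) = \<sigma> j * a j"
  proof (rule eventually_sequentiallyI[of j])
    fix N assume N: "N \<ge> j"
    have "inner (K (\<Sum>i=1..N. a i *\<^sub>R v i)) (u j) = (\<Sum>i=1..N. inner (K (a i *\<^sub>R v i)) (u j))"
      by (simp add: sum inner_sum_left)
    also have "\<dots> = (\<Sum>i=1..N. if i = j then \<sigma> j * a j else 0)"
      using svd j by (intro sum.cong refl) (auto simp: is_svd_def scale)
    also have "\<dots> = \<sigma> j * a j" using N j by simp
    finally show "inner (K (\<Sum>i=1..N. a i *\<^sub>R v i)) (u j) = \<sigma> j * a j" .
  qed
  show ?thesis by (rule LIMSEQ_unique[OF lim tendsto_eventually[OF ev]])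
qed

text \<open>Only finite sums are estimated: for each large \<open>N\<close> the squared distance to
  the partial sum is given by orthonormality, and the bound passes to the limit. This keeps the
  later error analysis free of infinite series.\<close>

lemma norm_truncated_diff_le:
  fixes v :: "nat \<Rightarrow> 'a::real_inner"
  assumes ortho: "\<And>i j. i \<ge> 1 \<Longrightarrow> j \<ge> 1 \<Longrightarrow> inner (v i) (v j) = (if i = j then 1 else 0)"
    and sum: "((\<lambda>j. x j *\<^sub>R v j) has_sum z) {1..}"
    and bound: "\<And>N. N \<ge> m \<Longrightarrow> (\<Sum>j=1..k. (y j - x j)\<^sup>2) + (\<Sum>j=k+1..N. (x j)\<^sup>2) \<le> B"
  shows "norm ((\<Sum>j=1..k. y j *\<^sub>R v j) - z) \<le> sqrt B"
proof (rule Lim_bounded)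
  show "(\<lambda>N. norm ((\<Sum>j=1..k. y j *\<^sub>R v j) - (\<Sum>j=1..N. x j *\<^sub>R v j)))
      \<longlonglongrightarrow> norm ((\<Sum>j=1..k. y j *\<^sub>R v j) - z)"
    by (intro tendsto_intros has_sum_from_1_partial_sums sum)
  show "\<forall>N\<ge>max k m. norm ((\<Sum>j=1..k. y j *\<^sub>R v j) - (\<Sum>j=1..N. x j *\<^sub>R v j)) \<le> sqrt B"
  proof (intro allI impI)
    fix N assume N: "max k m \<le> N"
    define b where "b j = (if j \<le> k then y j - x j else - x j)" for j
    have split: "{1..N} = {1..k} \<union> {k+1..N}" "{1..k} \<inter> {k+1..N} = {}" using N by auto
    have "(\<Sum>j=1..k. y j *\<^sub>R v j) - (\<Sum>j=1..N. x j *\<^sub>R v j) = (\<Sum>j=1..N. b j *\<^sub>R v j)"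
      unfolding split(1) sum.union_disjoint[OF finite_atLeastAtMost finite_atLeastAtMost split(2)]
      by (simp add: b_def algebra_simps sum_subtractf sum_negf)
    then have "(norm ((\<Sum>j=1..k. y j *\<^sub>R v j) - (\<Sum>j=1..N. x j *\<^sub>R v j)))\<^sup>2 = (\<Sum>j=1..N. (b j)\<^sup>2)"
      using norm_sum_orthonormal[of "{1..N}" v b] ortho by simp
    also have "\<dots> = (\<Sum>j=1..k. (y j - x j)\<^sup>2) + (\<Sum>j=k+1..N. (x j)\<^sup>2)"
      unfolding split(1) sum.union_disjoint[OF finite_atLeastAtMost finite_atLeastAtMost split(2)]
      by (simp add: b_def)
    also have "\<dots> \<le> B" using bound N by simp
    finally show "norm ((\<Sum>j=1..k. y j *\<^sub>R v j) - (\<Sum>j=1..N. x j *\<^sub>R v j)) \<le> sqrt B"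
      by (rule real_le_rsqrt)
  qed
qed

subsection \<open>The squared weights\<close>

text \<open>After multiplication by the squared singular value the recursion is a running minimum:
  the previous value enters unchanged. Monotonicity and lower bounds of the weights then follow by
  plain induction.\<close>

lemma mdp_dsq_Suc:
  assumes "j \<ge> 1" "\<sigma> (Suc j) > 0" "s2 (Suc j) > 0"
  shows "(\<sigma> (Suc j))\<^sup>2 * mdp_dsq \<sigma> \<epsilon>2 s2 S (Suc j) =
    min ((\<sigma> (Suc j))\<^sup>2 * (real (Suc j) powr (-(1 + \<epsilon>2)) * S / s2 (Suc j))) ((\<sigma> j)\<^sup>2 * mdp_dsq \<sigma> \<epsilon>2 s2 S j)"
  using assms by (simp add: Let_def min_mult_distrib_left)

lemma mdp_dsq_1:
  assumes "\<sigma> 1 > 0" "s2 1 > 0"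
  shows "(\<sigma> 1)\<^sup>2 * mdp_dsq \<sigma> \<epsilon>2 s2 S 1 = min ((\<sigma> 1)\<^sup>2 * (S / s2 1)) 1"
  using assms by (simp add: min_mult_distrib_left)

lemma mdp_dsq_antimono:
  assumes "\<And>j. j \<ge> 1 \<Longrightarrow> \<sigma> j > 0" "\<And>j. 1 \<le> j \<Longrightarrow> j \<le> m \<Longrightarrow> s2 j > 0" "1 \<le> i" "i \<le> j" "j \<le> m"
  shows "(\<sigma> j)\<^sup>2 * mdp_dsq \<sigma> \<epsilon>2 s2 S j \<le> (\<sigma> i)\<^sup>2 * mdp_dsq \<sigma> \<epsilon>2 s2 S i"
  using assms(4,5)
proof (induction j rule: dec_induct)
  case (step k)
  have "(\<sigma> (Suc k))\<^sup>2 * mdp_dsq \<sigma> \<epsilon>2 s2 S (Suc k) \<le> (\<sigma> k)\<^sup>2 * mdp_dsq \<sigma> \<epsilon>2 s2 S k"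
    by (subst mdp_dsq_Suc) (use assms step in auto)
  then show ?case using step by simp
qed simp

text \<open>This keeps the first argument of the minimum. It serves twice: summed over
  \<open>j\<close> it bounds the noise level from above, and with a lower bound on the sample
  variance it bounds each weight.\<close>

lemma mdp_dsq_weighted_variance_le:
  assumes "j \<ge> 1" "s2 j > 0"
  shows "mdp_dsq \<sigma> \<epsilon>2 s2 S j * s2 j \<le> real j powr (-(1 + \<epsilon>2)) * S"
proof -
  obtain i where j: "j = Suc i" using assms(1) by (cases j) auto
  have "mdp_dsq \<sigma> \<epsilon>2 s2 S j \<le> real j powr (-(1 + \<epsilon>2)) * S / s2 j"
    using assms(2) by (auto simp: j Let_def)
  then show ?thesis using assms(2) by (simp add: pos_le_divide_eq)
qed

text \<open>A running minimum stays above a nonincreasing sequence if every competitor does. The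
  competitor 1 at the first index is the reason for \<open>c \<le> 1\<close>, and \<theta> \<ge> 0
  gives the monotonicity.\<close>

lemma mdp_dsq_lower:
  assumes "\<And>j. j \<ge> 1 \<Longrightarrow> \<sigma> j > 0" "\<And>j. 1 \<le> j \<Longrightarrow> j \<le> m \<Longrightarrow> s2 j > 0"
    and c: "0 \<le> c" "c \<le> 1" and "\<theta> \<ge> 0"
    and b: "\<And>j. 1 \<le> j \<Longrightarrow> j \<le> m \<Longrightarrow>
      c * real j powr (-\<theta>) \<le> (\<sigma> j)\<^sup>2 * (real j powr (-(1 + \<epsilon>2)) * S / s2 j)"
    and "1 \<le> j" "j \<le> m"
  shows "c * real j powr (-\<theta>) \<le> (\<sigma> j)\<^sup>2 * mdp_dsq \<sigma> \<epsilon>2 s2 S j"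
  using assms(7,8)
proof (induction j rule: dec_induct)
  case base
  then show ?case
    by (subst mdp_dsq_1) (use assms(1,2) b[of 1] c in auto)
next
  case (step k)
  have "c * real (Suc k) powr (-\<theta>) \<le> c * real k powr (-\<theta>)"
    using step c \<open>\<theta> \<ge> 0\<close> by (intro mult_left_mono powr_mono2') auto
  then show ?case
    by (subst mdp_dsq_Suc) (use assms(1,2) b[of "Suc k"] step in auto)
qed

text \<open>The noise term \<open>t powr \<theta> / n\<close> grows in \<open>t\<close> and the bias
  term \<open>t powr (-\<beta>)\<close> decreases. They meet at
  \<open>t = n powr (1 / (\<beta> + \<theta>))\<close>, where both equal the squared rate.\<close>

lemma balance_powr:
  fixes \<theta> \<beta> t n :: real
  assumes "\<theta> > 0" "\<beta> > 0" "t \<ge> 1" "n \<ge> 1"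
  shows "t powr \<theta> / n \<le> n powr (-(\<beta> / (\<beta> + \<theta>))) \<or> t powr (-\<beta>) \<le> n powr (-(\<beta> / (\<beta> + \<theta>)))"
proof (cases "t \<le> n powr (1 / (\<beta> + \<theta>))")
  case True
  have "t powr \<theta> / n \<le> (n powr (1 / (\<beta> + \<theta>))) powr \<theta> / n"
    using assms True by (intro divide_right_mono powr_mono2) auto
  also have "\<dots> = n powr (\<theta> / (\<beta> + \<theta>) - 1)"
    using assms by (simp add: powr_powr powr_diff)
  also have "\<theta> / (\<beta> + \<theta>) - 1 = - (\<beta> / (\<beta> + \<theta>))" using assms by (simp add: field_simps)
  finally show ?thesis by blast
next
  case False
  then have "t powr (-\<beta>) \<le> (n powr (1 / (\<beta> + \<theta>))) powr (-\<beta>)"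
    using assms by (intro powr_mono2') auto
  also have "\<dots> = n powr (-(\<beta> / (\<beta> + \<theta>)))" using assms by (simp add: powr_powr)
  finally show ?thesis by blast
qed

subsection \<open>Deterministic error analysis of the stopping rule\<close>

text \<open>What the stopping rule sees on the event of high probability, reduced to real sequences:
  \<open>D\<close> are squared weights, \<open>e\<close> noise and \<open>x\<close> signal
  coefficients, \<xi> source coefficients, and \<open>\<delta>2\<close> the squared noise level.
  Noise is controlled in weighted form beyond \<open>J\<close> and in amplified form up to
  \<open>J\<close>; the bound on \<open>J\<close> keeps the inverse weights up to \<open>J\<close>
  below \<open>n * r / c\<close>.\<close>

locale weighted_stopping =
  fixes \<sigma> D x e \<xi> :: "nat \<Rightarrow> real" and m J k :: nat
    and n \<delta>2 \<theta> \<beta> c c0 C0 G \<rho> r :: real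
  assumes n: "n \<ge> 1" and \<theta>: "\<theta> > 0" and \<beta>: "\<beta> > 0" and c: "c > 0" and c0: "c0 > 0" and G: "G \<ge> 0"
    and r: "r = n powr (-(\<beta> / (\<beta> + \<theta>)))"
    and \<sigma>_pos: "\<And>j. j \<ge> 1 \<Longrightarrow> \<sigma> j > 0"
    and anti: "\<And>i j. 1 \<le> i \<Longrightarrow> i \<le> j \<Longrightarrow> j \<le> m \<Longrightarrow> (\<sigma> j)\<^sup>2 * D j \<le> (\<sigma> i)\<^sup>2 * D i"
    and low: "\<And>j. 1 \<le> j \<Longrightarrow> j \<le> m \<Longrightarrow> c * real j powr (-\<theta>) \<le> (\<sigma> j)\<^sup>2 * D j"
    and src: "\<And>j. 1 \<le> j \<Longrightarrow> (x j)\<^sup>2 \<le> G * real j powr (-\<beta>) * (\<xi> j)\<^sup>2"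
    and xi: "\<And>N. (\<Sum>j=1..N. (\<xi> j)\<^sup>2) \<le> \<rho>\<^sup>2"
    and \<delta>: "c0 / n \<le> \<delta>2" "\<delta>2 \<le> C0 / n"
    and noise_high: "(\<Sum>j\<in>{J<..m}. D j * (e j)\<^sup>2) \<le> c0 / (4 * n)"
    and noise_low: "(\<Sum>j=1..J. (e j)\<^sup>2 / (\<sigma> j)\<^sup>2) \<le> r"
    and J: "real J powr \<theta> \<le> n * r"
    and k: "k \<le> m"
    and stop: "(\<Sum>j=k+1..m. D j * (\<sigma> j * x j + e j)\<^sup>2) \<le> \<delta>2"
    and not_stop: "k \<ge> 1 \<Longrightarrow> \<delta>2 < (\<Sum>j=k..m. D j * (\<sigma> j * x j + e j)\<^sup>2)"
begin

lemma r_pos: "r > 0"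
  using n by (simp add: r)

lemma weight_pos:
  assumes "1 \<le> j" "j \<le> m"
  shows "(\<sigma> j)\<^sup>2 * D j > 0"
proof -
  have "c * real j powr (-\<theta>) > 0" using c assms by simp
  then show ?thesis using low[OF assms] by linarith
qed

lemma D_pos: "1 \<le> j \<Longrightarrow> j \<le> m \<Longrightarrow> D j > 0"
  using weight_pos[of j] by (simp add: zero_less_mult_iff)

text \<open>\<open>1 / ((\<sigma> j)\<^sup>2 * D j)\<close> is the factor lost when a weighted data
  coefficient is turned into a solution coefficient.\<close>

lemma inverse_weight_le:
  assumes "1 \<le> j" "j \<le> m"
  shows "1 / ((\<sigma> j)\<^sup>2 * D j) \<le> real j powr \<theta> / c"
proof -
  have "1 / ((\<sigma> j)\<^sup>2 * D j) \<le> 1 / (c * real j powr (-\<theta>))"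
    using low[OF assms] c assms by (intro divide_left_mono mult_pos_pos weight_pos) auto
  also have "\<dots> = real j powr \<theta> / c" by (simp add: powr_minus field_simps)
  finally show ?thesis .
qed

lemma balance:
  assumes "j \<ge> 1"
  shows "real j powr \<theta> / n \<le> r \<or> real j powr (-\<beta>) \<le> r"
  unfolding r by (rule balance_powr) (use assms n \<theta> \<beta> in auto)

lemma xi_subset:
  assumes "finite F" "F \<subseteq> {1..}"
  shows "(\<Sum>j\<in>F. (\<xi> j)\<^sup>2) \<le> \<rho>\<^sup>2"
proof -
  have "(\<Sum>j\<in>F. (\<xi> j)\<^sup>2) \<le> (\<Sum>j=1..Max (insert 0 F). (\<xi> j)\<^sup>2)"
    using assms by (intro sum_mono2) auto
  then show ?thesis using xi order_trans by blast
qed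

lemma signal_tail:
  assumes "1 \<le> i"
  shows "(\<Sum>j=i..N. (x j)\<^sup>2) \<le> G * real i powr (-\<beta>) * \<rho>\<^sup>2"
proof -
  have "(\<Sum>j=i..N. (x j)\<^sup>2) \<le> (\<Sum>j=i..N. G * real i powr (-\<beta>) * (\<xi> j)\<^sup>2)"
  proof (rule sum_mono)
    fix j assume j: "j \<in> {i..N}"
    have "G * real j powr (-\<beta>) * (\<xi> j)\<^sup>2 \<le> G * real i powr (-\<beta>) * (\<xi> j)\<^sup>2"
      using j assms G \<beta> by (intro mult_right_mono mult_left_mono powr_mono2') auto
    then show "(x j)\<^sup>2 \<le> G * real i powr (-\<beta>) * (\<xi> j)\<^sup>2"
      using src[of j] j assms by auto
  qed
  also have "\<dots> \<le> G * real i powr (-\<beta>) * \<rho>\<^sup>2"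
    unfolding sum_distrib_left[symmetric] using assms G
    by (intro mult_left_mono xi_subset) auto
  finally show ?thesis .
qed

text \<open>If the residual test fails at \<open>k - 1 \<ge> J\<close>, the noise cannot be the reason, hence the signal
  part exceeds the noise level; this caps the noise amplification \<open>1 / (\<sigma>\<^sub>k\<^sup>2 D\<^sub>k)\<close>.\<close>

lemma noise_level_le:
  assumes "J < k"
  shows "c0 / (4 * n) / ((\<sigma> k)\<^sup>2 * D k) \<le> G * \<rho>\<^sup>2 * real k powr (-\<beta>)"
proof -
  have k1: "1 \<le> k" using assms by simp
  have D0: "D j \<ge> 0" if "j \<in> {k..m}" for j using D_pos[of j] that k1 by simp
  have "c0 / n < (\<Sum>j=k..m. D j * (\<sigma> j * x j + e j)\<^sup>2)"
    using not_stop[OF k1] \<delta> by simp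
  also have "\<dots> \<le> (\<Sum>j=k..m. 2 * ((\<sigma> j)\<^sup>2 * D j * (x j)\<^sup>2) + 2 * (D j * (e j)\<^sup>2))"
  proof (rule sum_mono)
    fix j assume j: "j \<in> {k..m}"
    have "(\<sigma> j * x j + e j)\<^sup>2 \<le> 2 * (\<sigma> j * x j)\<^sup>2 + 2 * (e j)\<^sup>2"
      using sum_squares_bound[of "\<sigma> j * x j" "e j"] by (simp add: power2_sum)
    from mult_left_mono[OF this D0[OF j]]
    show "D j * (\<sigma> j * x j + e j)\<^sup>2 \<le> 2 * ((\<sigma> j)\<^sup>2 * D j * (x j)\<^sup>2) + 2 * (D j * (e j)\<^sup>2)"
      by (simp add: power_mult_distrib algebra_simps)
  qed
  also have "\<dots> = 2 * (\<Sum>j=k..m. (\<sigma> j)\<^sup>2 * D j * (x j)\<^sup>2) + 2 * (\<Sum>j=k..m. D j * (e j)\<^sup>2)"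
    by (simp add: sum.distrib sum_distrib_left)
  also have "(\<Sum>j=k..m. D j * (e j)\<^sup>2) \<le> (\<Sum>j\<in>{J<..m}. D j * (e j)\<^sup>2)"
    using assms D_pos by (intro sum_mono2) (auto intro!: mult_nonneg_nonneg less_imp_le[OF D_pos])
  \<comment> \<open>The factor 2 from splitting the square makes the noise contribute at most
    \<open>c0 / (2 * n)\<close>, half of the lower bound for the noise level; the signal must supply
    the other half.\<close>
  also note noise_high
  also have "(\<Sum>j=k..m. (\<sigma> j)\<^sup>2 * D j * (x j)\<^sup>2) \<le> (\<Sum>j=k..m. (\<sigma> k)\<^sup>2 * D k * (x j)\<^sup>2)"
    using anti k1 by (intro sum_mono mult_right_mono) auto
  also have "\<dots> = (\<sigma> k)\<^sup>2 * D k * (\<Sum>j=k..m. (x j)\<^sup>2)" by (simp add: sum_distrib_left)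
  also have "\<dots> \<le> (\<sigma> k)\<^sup>2 * D k * (G * real k powr (-\<beta>) * \<rho>\<^sup>2)"
    using weight_pos[OF k1 k] signal_tail[OF k1] by (intro mult_left_mono) auto
  finally have "c0 / (4 * n) \<le> (\<sigma> k)\<^sup>2 * D k * (G * real k powr (-\<beta>) * \<rho>\<^sup>2)"
    using n by (simp add: field_simps)
  then have "c0 / (4 * n) \<le> G * \<rho>\<^sup>2 * real k powr (-\<beta>) * ((\<sigma> k)\<^sup>2 * D k)"
    by (simp only: mult_ac)
  then show ?thesis
    by (simp only: pos_divide_le_eq[OF weight_pos[OF k1 k]])
qed

text \<open>For \<open>k \<le> J\<close> the noise bound up to \<open>J\<close> suffices. Otherwise
  monotonicity puts the largest amplification beyond \<open>J\<close> at \<open>k\<close>, and the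
  amplified noise \<open>?h\<close> has two bounds: by \<open>k powr \<theta> / n\<close> from the
  weights, and by \<open>k powr (-\<beta>)\<close> from the failed test at \<open>k - 1\<close>. By
  balancing, one of them is of order \<open>r\<close>.\<close>

lemma noise_bound:
  "(\<Sum>j=1..k. (e j)\<^sup>2 / (\<sigma> j)\<^sup>2) \<le> (1 + G * \<rho>\<^sup>2 + c0 / (4 * c)) * r"
proof (cases "k \<le> J")
  case True
  have "(\<Sum>j=1..k. (e j)\<^sup>2 / (\<sigma> j)\<^sup>2) \<le> (\<Sum>j=1..J. (e j)\<^sup>2 / (\<sigma> j)\<^sup>2)"
    using True by (intro sum_mono2) auto
  also have "\<dots> \<le> 1 * r" using noise_low by simp
  also have "\<dots> \<le> (1 + G * \<rho>\<^sup>2 + c0 / (4 * c)) * r"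
    using r_pos G c0 c by (intro mult_right_mono) auto
  finally show ?thesis .
next
  case False
  then have Jk: "J < k" "1 \<le> k" by auto
  let ?h = "c0 / (4 * n) / ((\<sigma> k)\<^sup>2 * D k)"
  have "(\<Sum>j\<in>{J<..k}. (e j)\<^sup>2 / (\<sigma> j)\<^sup>2) \<le> (\<Sum>j\<in>{J<..k}. 1 / ((\<sigma> k)\<^sup>2 * D k) * (D j * (e j)\<^sup>2))"
  proof (rule sum_mono)
    fix j assume j: "j \<in> {J<..k}"
    then have j': "1 \<le> j" "j \<le> m" using k by auto
    have "(e j)\<^sup>2 / (\<sigma> j)\<^sup>2 = 1 / ((\<sigma> j)\<^sup>2 * D j) * (D j * (e j)\<^sup>2)"
      using D_pos[OF j'] by simp
    also have "\<dots> \<le> 1 / ((\<sigma> k)\<^sup>2 * D k) * (D j * (e j)\<^sup>2)"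
      using j j' k anti[of j k] weight_pos[OF j'] weight_pos[OF Jk(2) k] D_pos[OF j']
      by (intro mult_right_mono divide_left_mono mult_pos_pos[OF weight_pos weight_pos]) auto
    finally show "(e j)\<^sup>2 / (\<sigma> j)\<^sup>2 \<le> 1 / ((\<sigma> k)\<^sup>2 * D k) * (D j * (e j)\<^sup>2)" .
  qed
  also have "\<dots> = 1 / ((\<sigma> k)\<^sup>2 * D k) * (\<Sum>j\<in>{J<..k}. D j * (e j)\<^sup>2)" by (simp add: sum_distrib_left)
  also have "\<dots> \<le> 1 / ((\<sigma> k)\<^sup>2 * D k) * (\<Sum>j\<in>{J<..m}. D j * (e j)\<^sup>2)"
    using weight_pos[OF Jk(2) k] k D_pos
    by (intro mult_left_mono sum_mono2) (auto intro!: mult_nonneg_nonneg less_imp_le[OF D_pos])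
  also have "\<dots> \<le> 1 / ((\<sigma> k)\<^sup>2 * D k) * (c0 / (4 * n))"
    using weight_pos[OF Jk(2) k] noise_high by (intro mult_left_mono) auto
  finally have high: "(\<Sum>j\<in>{J<..k}. (e j)\<^sup>2 / (\<sigma> j)\<^sup>2) \<le> ?h" by (simp add: mult_ac)
  have h1: "?h \<le> G * \<rho>\<^sup>2 * real k powr (-\<beta>)" by (rule noise_level_le[OF Jk(1)])
  have "?h = c0 / (4 * n) * (1 / ((\<sigma> k)\<^sup>2 * D k))" by simp
  also have "\<dots> \<le> c0 / (4 * n) * (real k powr \<theta> / c)"
    using c0 n by (intro mult_left_mono inverse_weight_le Jk k) auto
  finally have h2: "?h \<le> c0 / (4 * c) * (real k powr \<theta> / n)" by (simp add: mult_ac)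
  have "?h \<le> (G * \<rho>\<^sup>2 + c0 / (4 * c)) * r"
    using balance[OF Jk(2)]
  proof
    assume "real k powr \<theta> / n \<le> r"
    then have "c0 / (4 * c) * (real k powr \<theta> / n) \<le> c0 / (4 * c) * r"
      using c0 c by (intro mult_left_mono) auto
    moreover have "0 \<le> G * \<rho>\<^sup>2 * r" using G r_pos by simp
    ultimately show ?thesis using h2 unfolding distrib_right by linarith
  next
    assume "real k powr (-\<beta>) \<le> r"
    then have "G * \<rho>\<^sup>2 * real k powr (-\<beta>) \<le> G * \<rho>\<^sup>2 * r"
      using G by (intro mult_left_mono) auto
    moreover have "0 \<le> c0 / (4 * c) * r" using c0 c r_pos by simp
    ultimately show ?thesis using h1 unfolding distrib_right by linarith
  qed
  moreover have "(\<Sum>j=1..k. (e j)\<^sup>2 / (\<sigma> j)\<^sup>2)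
      = (\<Sum>j=1..J. (e j)\<^sup>2 / (\<sigma> j)\<^sup>2) + (\<Sum>j\<in>{J<..k}. (e j)\<^sup>2 / (\<sigma> j)\<^sup>2)"
    using Jk by (subst sum.union_disjoint[symmetric]) (auto intro!: sum.cong)
  ultimately show ?thesis using high noise_low by (simp add: algebra_simps)
qed

text \<open>Up to \<open>J\<close> only the amplified noise is controlled, so the signal is
  recovered as data over \<sigma> minus noise over \<sigma>. The data part is small because the test
  succeeded at \<open>k\<close> and the inverse weights are at most
  \<open>n * r / c\<close>.\<close>

lemma bias_low:
  "(\<Sum>j\<in>{k<..m} \<inter> {..J}. (x j)\<^sup>2) \<le> (2 + 2 * C0 / c) * r"
proof -
  have "(\<Sum>j\<in>{k<..m} \<inter> {..J}. (x j)\<^sup>2) \<le> (\<Sum>j\<in>{k<..m} \<inter> {..J}.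
      2 * (n * r / c) * (D j * (\<sigma> j * x j + e j)\<^sup>2) + 2 * ((e j)\<^sup>2 / (\<sigma> j)\<^sup>2))"
  proof (rule sum_mono)
    fix j assume j: "j \<in> {k<..m} \<inter> {..J}"
    then have j': "1 \<le> j" "j \<le> m" by auto
    have \<sigma>: "\<sigma> j > 0" using \<sigma>_pos j' by simp
    have "x j = (\<sigma> j * x j + e j) / \<sigma> j - e j / \<sigma> j" using \<sigma> by (simp add: field_simps)
    then have "(x j)\<^sup>2 = ((\<sigma> j * x j + e j) / \<sigma> j - e j / \<sigma> j)\<^sup>2" by simp
    also have "\<dots> \<le> 2 * ((\<sigma> j * x j + e j) / \<sigma> j)\<^sup>2 + 2 * (e j / \<sigma> j)\<^sup>2"
      using sum_squares_bound[of "(\<sigma> j * x j + e j) / \<sigma> j" "- (e j / \<sigma> j)"] by (simp add: power2_diff)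
    also have "((\<sigma> j * x j + e j) / \<sigma> j)\<^sup>2 = 1 / ((\<sigma> j)\<^sup>2 * D j) * (D j * (\<sigma> j * x j + e j)\<^sup>2)"
      using D_pos[OF j'] by (simp add: power_divide)
    also have "1 / ((\<sigma> j)\<^sup>2 * D j) * (D j * (\<sigma> j * x j + e j)\<^sup>2)
        \<le> n * r / c * (D j * (\<sigma> j * x j + e j)\<^sup>2)"
    proof (rule mult_right_mono)
      have "real j powr \<theta> \<le> real J powr \<theta>" using j \<theta> by (intro powr_mono2) auto
      then have "real j powr \<theta> / c \<le> n * r / c" using J c by (intro divide_right_mono) auto
      then show "1 / ((\<sigma> j)\<^sup>2 * D j) \<le> n * r / c" using inverse_weight_le[OF j'] by linarith
    qed (use D_pos[OF j'] in auto)
    finally show "(x j)\<^sup>2 \<le> 2 * (n * r / c) * (D j * (\<sigma> j * x j + e j)\<^sup>2) + 2 * ((e j)\<^sup>2 / (\<sigma> j)\<^sup>2)"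
      by (simp add: power_divide)
  qed
  also have "\<dots> = 2 * (n * r / c) * (\<Sum>j\<in>{k<..m} \<inter> {..J}. D j * (\<sigma> j * x j + e j)\<^sup>2)
      + 2 * (\<Sum>j\<in>{k<..m} \<inter> {..J}. (e j)\<^sup>2 / (\<sigma> j)\<^sup>2)"
    by (simp add: sum.distrib sum_distrib_left)
  also have "\<dots> \<le> 2 * (n * r / c) * (C0 / n) + 2 * r"
  proof (intro add_mono mult_left_mono)
    have "(\<Sum>j\<in>{k<..m} \<inter> {..J}. D j * (\<sigma> j * x j + e j)\<^sup>2) \<le> (\<Sum>j=k+1..m. D j * (\<sigma> j * x j + e j)\<^sup>2)"
      by (intro sum_mono2) (auto intro!: mult_nonneg_nonneg less_imp_le[OF D_pos])
    then show "(\<Sum>j\<in>{k<..m} \<inter> {..J}. D j * (\<sigma> j * x j + e j)\<^sup>2) \<le> C0 / n"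
      using stop \<delta> by linarith
    have "(\<Sum>j\<in>{k<..m} \<inter> {..J}. (e j)\<^sup>2 / (\<sigma> j)\<^sup>2) \<le> (\<Sum>j=1..J. (e j)\<^sup>2 / (\<sigma> j)\<^sup>2)"
      by (intro sum_mono2) auto
    then show "(\<Sum>j\<in>{k<..m} \<inter> {..J}. (e j)\<^sup>2 / (\<sigma> j)\<^sup>2) \<le> r" using noise_low by linarith
  qed (use n r_pos c in auto)
  also have "\<dots> = (2 + 2 * C0 / c) * r" using n by (simp add: field_simps)
  finally show ?thesis .
qed

text \<open>Balancing is applied to each index separately. Either the inverse weight is at most
  \<open>n * r / c\<close>, and the residual and the weighted noise bound the signal, or the source
  condition alone gives the factor \<open>r\<close>. Adding both bounds avoids sorting the
  indices.\<close>

lemma bias_high: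
  "(\<Sum>j\<in>{k<..m} \<inter> {J<..}. (x j)\<^sup>2) \<le> ((2 * C0 + c0) / c + G * \<rho>\<^sup>2) * r"
proof -
  let ?F = "{k<..m} \<inter> {J<..}"
  have "(\<Sum>j\<in>?F. (x j)\<^sup>2) \<le> (\<Sum>j\<in>?F. n * r / c * (2 * (D j * (\<sigma> j * x j + e j)\<^sup>2)
      + 2 * (D j * (e j)\<^sup>2)) + G * r * (\<xi> j)\<^sup>2)"
  proof (rule sum_mono)
    fix j assume j: "j \<in> ?F"
    then have j': "1 \<le> j" "j \<le> m" by auto
    let ?R = "2 * (D j * (\<sigma> j * x j + e j)\<^sup>2) + 2 * (D j * (e j)\<^sup>2)"
    have D0: "D j > 0" by (rule D_pos[OF j'])
    have "(\<sigma> j * x j)\<^sup>2 \<le> 2 * (\<sigma> j * x j + e j)\<^sup>2 + 2 * (e j)\<^sup>2"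
      using sum_squares_bound[of "\<sigma> j * x j + e j" "- e j"]
      by (simp add: power2_eq_square algebra_simps)
    from mult_left_mono[OF this, of "D j"] D0
    have R: "(\<sigma> j)\<^sup>2 * D j * (x j)\<^sup>2 \<le> ?R" by (simp add: power_mult_distrib algebra_simps)
    have R0: "0 \<le> ?R" using D0 by simp
    show "(x j)\<^sup>2 \<le> n * r / c * ?R + G * r * (\<xi> j)\<^sup>2"
      using balance[OF j'(1)]
    proof
      assume "real j powr \<theta> / n \<le> r"
      then have "real j powr \<theta> / c \<le> n * r / c"
        using c n by (simp add: divide_right_mono pos_divide_le_eq mult.commute)
      then have "1 / ((\<sigma> j)\<^sup>2 * D j) \<le> n * r / c" using inverse_weight_le[OF j'] by linarith
      then have "1 / ((\<sigma> j)\<^sup>2 * D j) * ((\<sigma> j)\<^sup>2 * D j * (x j)\<^sup>2) \<le> n * r / c * ?R"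
        using R weight_pos[OF j'] n r_pos c by (intro mult_mono) auto
      moreover have "1 / ((\<sigma> j)\<^sup>2 * D j) * ((\<sigma> j)\<^sup>2 * D j * (x j)\<^sup>2) = (x j)\<^sup>2"
        using \<sigma>_pos[OF j'(1)] D0 by simp
      moreover have "0 \<le> G * r * (\<xi> j)\<^sup>2" using G r_pos by simp
      ultimately show ?thesis by linarith
    next
      assume "real j powr (-\<beta>) \<le> r"
      then have "G * real j powr (-\<beta>) * (\<xi> j)\<^sup>2 \<le> G * r * (\<xi> j)\<^sup>2"
        using G by (intro mult_right_mono mult_left_mono) auto
      moreover have "0 \<le> n * r / c * ?R" using R0 n r_pos c by simp
      ultimately show ?thesis using src[OF j'(1)] by linarith
    qed
  qed
  also have "\<dots> = n * r / c * (2 * (\<Sum>j\<in>?F. D j * (\<sigma> j * x j + e j)\<^sup>2)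
      + 2 * (\<Sum>j\<in>?F. D j * (e j)\<^sup>2)) + G * r * (\<Sum>j\<in>?F. (\<xi> j)\<^sup>2)"
    by (simp add: sum.distrib sum_distrib_left algebra_simps)
  also have "\<dots> \<le> n * r / c * (2 * (C0 / n) + 2 * (c0 / (4 * n))) + G * r * \<rho>\<^sup>2"
  proof (intro add_mono mult_left_mono)
    have "(\<Sum>j\<in>?F. D j * (\<sigma> j * x j + e j)\<^sup>2) \<le> (\<Sum>j=k+1..m. D j * (\<sigma> j * x j + e j)\<^sup>2)"
      by (intro sum_mono2) (auto intro!: mult_nonneg_nonneg less_imp_le[OF D_pos])
    then show "(\<Sum>j\<in>?F. D j * (\<sigma> j * x j + e j)\<^sup>2) \<le> C0 / n"
      using stop \<delta> by linarith
    have "(\<Sum>j\<in>?F. D j * (e j)\<^sup>2) \<le> (\<Sum>j\<in>{J<..m}. D j * (e j)\<^sup>2)"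
      by (intro sum_mono2) (auto intro!: mult_nonneg_nonneg less_imp_le[OF D_pos])
    then show "(\<Sum>j\<in>?F. D j * (e j)\<^sup>2) \<le> c0 / (4 * n)" using noise_high by linarith
    show "(\<Sum>j\<in>?F. (\<xi> j)\<^sup>2) \<le> \<rho>\<^sup>2" by (rule xi_subset) auto
  qed (use n r_pos c G in auto)
  also have "\<dots> = ((2 * C0 + c0 / 2) / c + G * \<rho>\<^sup>2) * r" using n c by (simp add: field_simps)
  also have "\<dots> \<le> ((2 * C0 + c0) / c + G * \<rho>\<^sup>2) * r"
    using r_pos c c0 by (intro mult_right_mono add_right_mono divide_right_mono) auto
  finally show ?thesis .
qed

text \<open>Beyond \<open>m\<close> the stopping rule has no information, so the source condition is
  used there; this gives the term in \<open>m\<close>, the origin of the second entry of the maximum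
  in the final rate.\<close>

lemma error_bound:
  assumes "m \<ge> 1" "N \<ge> m"
  shows "(\<Sum>j=1..k. (e j)\<^sup>2 / (\<sigma> j)\<^sup>2) + (\<Sum>j=k+1..N. (x j)\<^sup>2)
    \<le> (3 + (4 * C0 + 2 * c0) / c + 2 * G * \<rho>\<^sup>2) * r + G * \<rho>\<^sup>2 * real m powr (-\<beta>)"
proof -
  have "(\<Sum>j=k+1..N. (x j)\<^sup>2) = (\<Sum>j=k+1..m. (x j)\<^sup>2) + (\<Sum>j=m+1..N. (x j)\<^sup>2)"
    using k assms by (subst sum.union_disjoint[symmetric]) (auto intro!: sum.cong)
  also have "(\<Sum>j=k+1..m. (x j)\<^sup>2)
      = (\<Sum>j\<in>{k<..m} \<inter> {..J}. (x j)\<^sup>2) + (\<Sum>j\<in>{k<..m} \<inter> {J<..}. (x j)\<^sup>2)"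
    by (subst sum.union_disjoint[symmetric]) (auto intro!: sum.cong)
  also have "(\<Sum>j=m+1..N. (x j)\<^sup>2) \<le> (\<Sum>j=m..N. (x j)\<^sup>2)" by (intro sum_mono2) auto
  also have "\<dots> \<le> G * real m powr (-\<beta>) * \<rho>\<^sup>2" by (rule signal_tail[OF assms(1)])
  finally have "(\<Sum>j=k+1..N. (x j)\<^sup>2) \<le> (2 + 2 * C0 / c) * r + ((2 * C0 + c0) / c + G * \<rho>\<^sup>2) * r
      + G * real m powr (-\<beta>) * \<rho>\<^sup>2"
    using bias_low bias_high by linarith
  \<comment> \<open>The weaker constant lets the noise and bias contributions add up to the stated
    one.\<close>
  moreover have "c0 / (4 * c) * r \<le> c0 / c * r"
    using c0 c r_pos by (intro mult_right_mono divide_left_mono) auto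
  ultimately show ?thesis using noise_bound by (simp add: algebra_simps add_divide_distrib)
qed

end

section \<open>The modified discrepancy principle for data with controlled sample variances and
  noise\<close>

locale mdp_problem =
  fixes \<sigma> :: "nat \<Rightarrow> real" and u :: "nat \<Rightarrow> 'y::real_inner" and v :: "nat \<Rightarrow> 'x::real_inner"
    and xhat \<xi> :: 'x and yhat :: 'y and a :: "nat \<Rightarrow> real"
    and p q \<epsilon>1 \<epsilon>2 \<nu> \<rho> Cp c1 c2 Z :: real
  assumes \<sigma>_pos: "\<And>j. j \<ge> 1 \<Longrightarrow> \<sigma> j > 0"
    and v_ortho: "\<And>i j. i \<ge> 1 \<Longrightarrow> j \<ge> 1 \<Longrightarrow> inner (v i) (v j) = (if i = j then 1 else 0)"
    and x_sum: "((\<lambda>j. (\<sigma> j powr \<nu> * inner \<xi> (v j)) *\<^sub>R v j) has_sum xhat) {1..}"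
    and y_coeff: "\<And>j. j \<ge> 1 \<Longrightarrow> inner yhat (u j) = \<sigma> j * (\<sigma> j powr \<nu> * inner \<xi> (v j))"
    and \<xi>_norm: "norm \<xi> \<le> \<rho>"
    and \<sigma>_lower: "\<And>j. j \<ge> 1 \<Longrightarrow> c1 * real j powr (-q) \<le> (\<sigma> j)\<^sup>2"
    and \<sigma>_upper: "\<And>j. j \<ge> 1 \<Longrightarrow> (\<sigma> j)\<^sup>2 \<le> c2 * real j powr (-q)"
    and a_pos: "\<And>j. j \<ge> 1 \<Longrightarrow> 0 < a j"
    and a_upper: "\<And>j. j \<ge> 1 \<Longrightarrow> a j \<le> Cp * real j powr (-p)"
    and pos: "Cp > 0" "c1 > 0" "c2 > 0" "\<nu> > 0"
    and pq: "p - 1 < q" "0 < \<epsilon>2" "\<epsilon>2 < p - 1"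
    and Z: "\<And>N. (\<Sum>j=1..N. real j powr (-(1 + \<epsilon>2))) \<le> Z"
begin

definition "\<theta> = q + 1 + \<epsilon>2 - p"
definition "\<beta> = q * \<nu>"
definition "\<alpha> = \<beta> / (\<beta> + \<theta>)"
text \<open>\<open>c\<close> is the worst case of the first argument in the weight recursion when
  \<open>S\<close> is at least \<open>a 1 / 2\<close> and the sample variances are at most
  \<open>3 * a j\<close>, capped by 1 for the start value. \<open>c0\<close> bounds from below the
  summand \<open>j = 1\<close> of the squared noise level times \<open>n\<close>. In
  \<open>C0\<close> one factor \<open>Z\<close> comes from bounding \<open>S\<close>, the other from
  summing the weighted variances.\<close>

definition "c = min 1 (c1 * a 1 / (6 * Cp))"
definition "c0 = c / (\<sigma> 1)\<^sup>2 * (a 1 / 2)"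
definition "C0 = 3 * Cp * Z\<^sup>2"
definition "G = c2 powr \<nu>"

lemma \<theta>_pos: "\<theta> > 0" and \<beta>_pos: "\<beta> > 0"
  using pq pos by (auto simp: \<theta>_def \<beta>_def)

lemma \<alpha>_less_1: "\<alpha> < 1"
  using \<theta>_pos \<beta>_pos by (simp add: \<alpha>_def)

lemma c_pos: "0 < c" and c_le_1: "c \<le> 1"
  using a_pos[of 1] pos by (auto simp: c_def)

lemma c0_pos: "0 < c0"
  using c_pos a_pos[of 1] \<sigma>_pos[of 1] by (simp add: c0_def)

lemma Z_ge_1: "1 \<le> Z"
  using Z[of 1] by simp

lemma source_coeff_bound:
  assumes "1 \<le> j"
  shows "(\<sigma> j powr \<nu> * inner \<xi> (v j))\<^sup>2 \<le> G * real j powr (-\<beta>) * (inner \<xi> (v j))\<^sup>2"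
proof -
  have "(\<sigma> j powr \<nu>)\<^sup>2 = ((\<sigma> j)\<^sup>2) powr \<nu>"
    using \<sigma>_pos[OF assms] by (simp add: power2_eq_square powr_mult)
  also have "\<dots> \<le> (c2 * real j powr (-q)) powr \<nu>"
    using \<sigma>_upper[OF assms] pos by (intro powr_mono2) auto
  also have "\<dots> = G * real j powr (-\<beta>)"
    using pos by (simp add: powr_mult powr_powr G_def \<beta>_def)
  finally show ?thesis by (simp add: power_mult_distrib mult_right_mono)
qed

text \<open>The assumptions on \<open>y\<close> describe the good event, and the proof verifies the
  conditions of \<open>weighted_stopping\<close> for it. Since \<open>D j\<close> is at most
  \<open>6 * Cp * Z\<close> times the weight in the assumption on high indices, the constant there
  produces exactly \<open>c0 / (4 * n)\<close>.\<close>

lemma mdp_error_bound: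
  fixes y :: "nat \<Rightarrow> 'y" and n J :: nat
  defines "m \<equiv> mdp_m \<epsilon>1 n"
  assumes n: "n \<ge> 1" and m: "m \<ge> 1"
    and s2: "\<And>j. 1 \<le> j \<Longrightarrow> j \<le> m \<Longrightarrow> a j / 2 \<le> mdp_s2 u n y j \<and> mdp_s2 u n y j \<le> 3 * a j"
    and high: "(\<Sum>j\<in>{J<..m}. real j powr (-(1 + \<epsilon>2)) / a j * (inner (Ybar n y - yhat) (u j))\<^sup>2)
        \<le> c0 / (24 * Cp * Z) / n"
    and low: "(\<Sum>j=1..J. 1 / (\<sigma> j)\<^sup>2 * (inner (Ybar n y - yhat) (u j))\<^sup>2) \<le> real n powr (-\<alpha>)"
    and J: "real J powr \<theta> \<le> real n powr (1 - \<alpha>)"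
  shows "norm (Xbar \<sigma> u v n y (mdp_k \<epsilon>1 \<epsilon>2 \<sigma> u n y) - xhat) \<le>
    sqrt ((3 + (4 * C0 + 2 * c0) / c + 2 * G * \<rho>\<^sup>2) * real n powr (-\<alpha>) + G * \<rho>\<^sup>2 * real m powr (-\<beta>))"
proof -
  let ?s = "mdp_s2 u n y" and ?S = "mdp_S \<epsilon>1 u n y"
  define D where "D = mdp_dsq \<sigma> \<epsilon>2 ?s ?S"
  define k where "k = mdp_k \<epsilon>1 \<epsilon>2 \<sigma> u n y"
  define \<delta>2 where "\<delta>2 = (mdp_delta \<epsilon>1 \<epsilon>2 \<sigma> u n y)\<^sup>2"
  define e where "e j = inner (Ybar n y - yhat) (u j)" for j
  define x where "x j = \<sigma> j powr \<nu> * inner \<xi> (v j)" for j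
  have spos: "?s j > 0" if "1 \<le> j" "j \<le> m" for j
    using s2[OF that] a_pos[of j] that by simp
  have S_low: "a 1 / 2 \<le> ?S"
  proof -
    have "?s 1 \<le> ?S"
      unfolding mdp_S_def m_def[symmetric] using m
      by (intro member_le_sum) (auto intro: less_imp_le[OF spos])
    then show ?thesis using s2[of 1] m by simp
  qed
  have S_up: "?S \<le> 3 * Cp * Z"
  proof -
    have "?S \<le> (\<Sum>j=1..m. 3 * Cp * real j powr (-(1 + \<epsilon>2)))"
      unfolding mdp_S_def m_def[symmetric]
    proof (rule sum_mono)
      fix j assume j: "j \<in> {1..m}"
      have "real j powr (-p) \<le> real j powr (-(1 + \<epsilon>2))"
        using j pq by (intro powr_mono) auto
      then have "Cp * real j powr (-p) \<le> Cp * real j powr (-(1 + \<epsilon>2))"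
        using pos by (intro mult_left_mono) auto
      then show "?s j \<le> 3 * Cp * real j powr (-(1 + \<epsilon>2))"
        using s2[of j] a_upper[of j] j by auto
    qed
    also have "\<dots> \<le> 3 * Cp * Z"
      unfolding sum_distrib_left[symmetric] using pos Z by (intro mult_left_mono) auto
    finally show ?thesis .
  qed
  have S_pos: "?S > 0" using S_low a_pos[of 1] by simp
  have ratio: "c * real j powr (-\<theta>) \<le> (\<sigma> j)\<^sup>2 * (real j powr (-(1 + \<epsilon>2)) * ?S / ?s j)"
    if j: "1 \<le> j" "j \<le> m" for j
  proof -
    have "c * real j powr (-\<theta>) \<le> c1 * a 1 / (6 * Cp) * real j powr (-\<theta>)"
      by (intro mult_right_mono) (auto simp: c_def)
    \<comment> \<open>The exponents match because -\<theta> = -q - (1 + \<epsilon>2) + p, and 6 = 2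
      * 3 combines the lower bound on \<open>S\<close> with the upper bound on the
      variances.\<close>
    also have "\<dots> = (c1 * real j powr (-q)) * (real j powr (-(1 + \<epsilon>2)) * (a 1 / 2) / (3 * (Cp * real j powr (-p))))"
      using j pos by (simp add: \<theta>_def powr_diff powr_minus powr_add field_simps)
    also have "\<dots> \<le> (\<sigma> j)\<^sup>2 * (real j powr (-(1 + \<epsilon>2)) * ?S / ?s j)"
      using \<sigma>_lower[of j] S_low spos[OF j] s2[OF j] a_upper[of j] j a_pos[of 1] pos
      by (intro mult_mono frac_le) auto
    finally show ?thesis .
  qed
  have D_low: "c * real j powr (-\<theta>) \<le> (\<sigma> j)\<^sup>2 * D j" if "1 \<le> j" "j \<le> m" for j
    unfolding D_def
    by (rule mdp_dsq_lower[where m = m])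
      (use \<sigma>_pos spos c_pos c_le_1 \<theta>_pos ratio that in \<open>auto simp: less_imp_le\<close>)
  have D_pos: "D j > 0" if j: "1 \<le> j" "j \<le> m" for j
  proof -
    have "0 < c * real j powr (-\<theta>)" using c_pos j by simp
    then have "0 < (\<sigma> j)\<^sup>2 * D j" using D_low[OF j] by linarith
    then show ?thesis by (simp add: zero_less_mult_iff)
  qed
  have D_s: "D j * ?s j \<le> real j powr (-(1 + \<epsilon>2)) * (3 * Cp * Z)" if j: "1 \<le> j" "j \<le> m" for j
  proof -
    have "D j * ?s j \<le> real j powr (-(1 + \<epsilon>2)) * ?S"
      unfolding D_def using j spos by (intro mdp_dsq_weighted_variance_le) auto
    also have "\<dots> \<le> real j powr (-(1 + \<epsilon>2)) * (3 * Cp * Z)"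
      using S_up by (intro mult_left_mono) auto
    finally show ?thesis .
  qed
  have D_up: "D j \<le> 6 * Cp * Z * (real j powr (-(1 + \<epsilon>2)) / a j)" if j: "1 \<le> j" "j \<le> m" for j
  proof -
    have "D j * (a j / 2) \<le> D j * ?s j"
      using D_pos[OF j] s2[OF j] by (intro mult_left_mono) auto
    with D_s[OF j] have "D j * (a j / 2) \<le> real j powr (-(1 + \<epsilon>2)) * (3 * Cp * Z)" by linarith
    then show ?thesis using a_pos[of j] j by (simp add: field_simps)
  qed
  have d_sq: "(mdp_d \<epsilon>1 \<epsilon>2 \<sigma> u n y j)\<^sup>2 = D j" if "1 \<le> j" "j \<le> m" for j
    using D_pos[OF that] by (simp add: mdp_d_def D_def)
  have \<delta>2: "\<delta>2 = 1 / real n * (\<Sum>j=1..m. D j * ?s j)"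
  proof -
    have "(\<Sum>j=1..m. (mdp_d \<epsilon>1 \<epsilon>2 \<sigma> u n y j)\<^sup>2 * ?s j) = (\<Sum>j=1..m. D j * ?s j)"
      using d_sq by (intro sum.cong) auto
    moreover have "0 \<le> (\<Sum>j=1..m. D j * ?s j)"
      by (intro sum_nonneg mult_nonneg_nonneg) (auto intro: less_imp_le[OF spos] less_imp_le[OF D_pos])
    ultimately show ?thesis by (simp add: \<delta>2_def mdp_delta_def m_def)
  qed
  have delta_nonneg: "0 \<le> mdp_delta \<epsilon>1 \<epsilon>2 \<sigma> u n y"
  proof -
    have "0 \<le> (\<Sum>j=1..m. (mdp_d \<epsilon>1 \<epsilon>2 \<sigma> u n y j)\<^sup>2 * ?s j)"
      by (intro sum_nonneg mult_nonneg_nonneg) (auto intro: less_imp_le[OF spos])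
    then show ?thesis by (simp add: mdp_delta_def m_def)
  qed
  have coeff: "inner (Ybar n y) (u j) = \<sigma> j * x j + e j" if "1 \<le> j" for j
    using y_coeff[OF that] by (simp add: e_def x_def inner_diff_left)
  have resid: "(\<Sum>j=i+1..m. (mdp_d \<epsilon>1 \<epsilon>2 \<sigma> u n y j)\<^sup>2 * (inner (Ybar n y) (u j))\<^sup>2)
      = (\<Sum>j=i+1..m. D j * (\<sigma> j * x j + e j)\<^sup>2)" for i
    using d_sq coeff by (intro sum.cong) auto
  have k: "k = (LEAST k. k \<le> m \<and> sqrt (\<Sum>j=k+1..m. D j * (\<sigma> j * x j + e j)\<^sup>2) \<le> mdp_delta \<epsilon>1 \<epsilon>2 \<sigma> u n y)"
    unfolding k_def mdp_k_def m_def[symmetric] resid ..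
  \<comment> \<open>The minimum exists: at \<open>m\<close> the residual sum is empty and the noise
    level is nonnegative.\<close>
  have k_le: "k \<le> m \<and> sqrt (\<Sum>j=k+1..m. D j * (\<sigma> j * x j + e j)\<^sup>2) \<le> mdp_delta \<epsilon>1 \<epsilon>2 \<sigma> u n y"
    unfolding k by (rule LeastI[of _ m]) (use delta_nonneg in auto)
  interpret W: weighted_stopping \<sigma> D x e "\<lambda>j. inner \<xi> (v j)" m J k n \<delta>2 \<theta> \<beta> c c0 C0 G \<rho> "real n powr (-\<alpha>)"
  proof
    show "real n \<ge> 1" using n by simp
    show "\<theta> > 0" "\<beta> > 0" "c > 0" "c0 > 0" by (rule \<theta>_pos \<beta>_pos c_pos c0_pos)+
    show "G \<ge> 0" by (simp add: G_def)
    show "real n powr (-\<alpha>) = real n powr (-(\<beta> / (\<beta> + \<theta>)))" by (simp add: \<alpha>_def)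
    show "\<sigma> j > 0" if "j \<ge> 1" for j using that by (rule \<sigma>_pos)
    show "(\<sigma> j)\<^sup>2 * D j \<le> (\<sigma> i)\<^sup>2 * D i" if "1 \<le> i" "i \<le> j" "j \<le> m" for i j
      unfolding D_def by (rule mdp_dsq_antimono[where m = m]) (use that \<sigma>_pos spos in auto)
    show "c * real j powr (-\<theta>) \<le> (\<sigma> j)\<^sup>2 * D j" if "1 \<le> j" "j \<le> m" for j
      using that by (rule D_low)
    show "(x j)\<^sup>2 \<le> G * real j powr (-\<beta>) * (inner \<xi> (v j))\<^sup>2" if "1 \<le> j" for j
      unfolding x_def using that by (rule source_coeff_bound)
    show "(\<Sum>j=1..N. (inner \<xi> (v j))\<^sup>2) \<le> \<rho>\<^sup>2" for N
    proof -
      have "(\<Sum>j=1..N. (inner \<xi> (v j))\<^sup>2) \<le> (norm \<xi>)\<^sup>2"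
        using v_ortho by (intro bessel_inequality) auto
      also have "\<dots> \<le> \<rho>\<^sup>2" using \<xi>_norm by (intro power_mono) auto
      finally show ?thesis .
    qed
    show "c0 / n \<le> \<delta>2"
    proof -
      have "c \<le> (\<sigma> 1)\<^sup>2 * D 1" using D_low[of 1] m by simp
      then have "c / (\<sigma> 1)\<^sup>2 \<le> D 1" using \<sigma>_pos[of 1] by (simp add: pos_divide_le_eq mult.commute)
      then have "c0 \<le> D 1 * ?s 1"
        unfolding c0_def using s2[of 1] m D_pos[of 1] a_pos[of 1] by (intro mult_mono) auto
      also have "\<dots> \<le> (\<Sum>j=1..m. D j * ?s j)"
        using m by (intro member_le_sum[where f = "\<lambda>j. D j * ?s j"])
          (auto intro!: mult_nonneg_nonneg intro: less_imp_le[OF spos] less_imp_le[OF D_pos])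
      finally show ?thesis unfolding \<delta>2 using n by (simp add: divide_right_mono)
    qed
    show "\<delta>2 \<le> C0 / n"
    proof -
      have "(\<Sum>j=1..m. D j * ?s j) \<le> (\<Sum>j=1..m. real j powr (-(1 + \<epsilon>2)) * (3 * Cp * Z))"
        using D_s by (intro sum_mono) auto
      also have "\<dots> \<le> Z * (3 * Cp * Z)"
        unfolding sum_distrib_right[symmetric] using Z pos Z_ge_1 by (intro mult_right_mono) auto
      finally show ?thesis unfolding \<delta>2 C0_def using n by (simp add: divide_right_mono power2_eq_square mult_ac)
    qed
    show "(\<Sum>j\<in>{J<..m}. D j * (e j)\<^sup>2) \<le> c0 / (4 * real n)"
    proof -
      have "(\<Sum>j\<in>{J<..m}. D j * (e j)\<^sup>2)
          \<le> (\<Sum>j\<in>{J<..m}. 6 * Cp * Z * (real j powr (-(1 + \<epsilon>2)) / a j * (e j)\<^sup>2))"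
      proof (rule sum_mono)
        fix j assume "j \<in> {J<..m}"
        then have "D j * (e j)\<^sup>2 \<le> 6 * Cp * Z * (real j powr (-(1 + \<epsilon>2)) / a j) * (e j)\<^sup>2"
          by (intro mult_right_mono D_up) auto
        then show "D j * (e j)\<^sup>2 \<le> 6 * Cp * Z * (real j powr (-(1 + \<epsilon>2)) / a j * (e j)\<^sup>2)"
          by (simp add: mult_ac)
      qed
      also have "\<dots> \<le> 6 * Cp * Z * (c0 / (24 * Cp * Z) / n)"
        unfolding sum_distrib_left[symmetric] e_def using high pos Z_ge_1 by (intro mult_left_mono) auto
      also have "\<dots> = c0 / (4 * real n)" using pos Z_ge_1 by (simp add: field_simps)
      finally show ?thesis .
    qed
    show "(\<Sum>j=1..J. (e j)\<^sup>2 / (\<sigma> j)\<^sup>2) \<le> real n powr (-\<alpha>)" using low by (simp add: e_def)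
    show "real J powr \<theta> \<le> real n * real n powr (-\<alpha>)"
      using J n by (simp add: powr_diff powr_minus field_simps)
    show "k \<le> m" using k_le by simp
    show "(\<Sum>j=k+1..m. D j * (\<sigma> j * x j + e j)\<^sup>2) \<le> \<delta>2"
      unfolding \<delta>2_def using k_le sqrt_le_D by blast
    show "\<delta>2 < (\<Sum>j=k..m. D j * (\<sigma> j * x j + e j)\<^sup>2)" if k1: "k \<ge> 1"
    proof -
      \<comment> \<open>Since \<open>k - 1 \<le> m\<close>, minimality can only be violated by the
        residual test; its sum at \<open>k - 1\<close> starts at index \<open>k\<close>.\<close>
      have "k - 1 < k" using k1 by simp
      from not_less_Least[OF this[unfolded k], folded k] k_le
      have "\<not> sqrt (\<Sum>j=(k-1)+1..m. D j * (\<sigma> j * x j + e j)\<^sup>2) \<le> mdp_delta \<epsilon>1 \<epsilon>2 \<sigma> u n y"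
        by (meson diff_le_self le_trans)
      then have not_le: "\<not> sqrt (\<Sum>j=k..m. D j * (\<sigma> j * x j + e j)\<^sup>2) \<le> mdp_delta \<epsilon>1 \<epsilon>2 \<sigma> u n y"
        using k1 by simp
      show ?thesis
      proof (rule ccontr)
        assume "\<not> ?thesis"
        then have "sqrt (\<Sum>j=k..m. D j * (\<sigma> j * x j + e j)\<^sup>2) \<le> mdp_delta \<epsilon>1 \<epsilon>2 \<sigma> u n y"
          using delta_nonneg by (intro real_le_lsqrt) (auto simp: \<delta>2_def)
        with not_le show False by simp
      qed
    qed
  qed
  have "norm ((\<Sum>j=1..k. (inner (Ybar n y) (u j) / \<sigma> j) *\<^sub>R v j) - xhat) \<le>
    sqrt ((3 + (4 * C0 + 2 * c0) / c + 2 * G * \<rho>\<^sup>2) * real n powr (-\<alpha>) + G * \<rho>\<^sup>2 * real m powr (-\<beta>))"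
  proof (rule norm_truncated_diff_le[OF v_ortho x_sum])
    fix N assume "N \<ge> m"
    moreover have "(\<Sum>j=1..k. (inner (Ybar n y) (u j) / \<sigma> j - \<sigma> j powr \<nu> * inner \<xi> (v j))\<^sup>2)
        = (\<Sum>j=1..k. (e j)\<^sup>2 / (\<sigma> j)\<^sup>2)"
    proof (intro sum.cong refl)
      fix j assume "j \<in> {1..k}"
      then have "inner (Ybar n y) (u j) / \<sigma> j - x j = e j / \<sigma> j"
        using coeff[of j] \<sigma>_pos[of j] by (simp add: field_simps)
      then show "(inner (Ybar n y) (u j) / \<sigma> j - \<sigma> j powr \<nu> * inner \<xi> (v j))\<^sup>2 = (e j)\<^sup>2 / (\<sigma> j)\<^sup>2"
        by (simp add: x_def power_divide)
    qed
    ultimately show "(\<Sum>j=1..k. (inner (Ybar n y) (u j) / \<sigma> j - \<sigma> j powr \<nu> * inner \<xi> (v j))\<^sup>2)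
        + (\<Sum>j=k+1..N. (\<sigma> j powr \<nu> * inner \<xi> (v j))\<^sup>2)
      \<le> (3 + (4 * C0 + 2 * c0) / c + 2 * G * \<rho>\<^sup>2) * real n powr (-\<alpha>) + G * \<rho>\<^sup>2 * real m powr (-\<beta>)"
      using W.error_bound[OF m, of N] by (simp add: x_def)
  qed
  then show ?thesis by (simp add: Xbar_def k_def)
qed

end

subsection \<open>Noise coefficients of the averaged data\<close>

locale iid_noise = prob_space M for M :: "'w measure" +
  fixes Y :: "nat \<Rightarrow> 'w \<Rightarrow> 'y::{real_inner,banach,second_countable_topology}"
    and yhat :: 'y and u :: "nat \<Rightarrow> 'y" and C :: real
  assumes Y_meas: "\<And>i. i \<ge> 1 \<Longrightarrow> Y i \<in> borel_measurable M"
    and Y_indep: "indep_vars (\<lambda>_. borel) Y {1..}"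
    and Y_ident: "\<And>i. i \<ge> 1 \<Longrightarrow> distr M borel (Y i) = distr M borel (Y 1)"
    and Y_int: "integrable M (Y 1)"
    and Y_mean: "expectation (Y 1) = yhat"
    and int2: "\<And>j. j \<ge> 1 \<Longrightarrow> integrable M (\<lambda>\<omega>. (inner (Y 1 \<omega> - yhat) (u j))^2)"
    and int4: "\<And>j. j \<ge> 1 \<Longrightarrow> integrable M (\<lambda>\<omega>. (inner (Y 1 \<omega> - yhat) (u j))^4)"
    and mom2: "\<And>j. j \<ge> 1 \<Longrightarrow> 0 < expectation (\<lambda>\<omega>. (inner (Y 1 \<omega> - yhat) (u j))^2)"
    and mom4: "\<And>j. j \<ge> 1 \<Longrightarrow> expectation (\<lambda>\<omega>. (inner (Y 1 \<omega> - yhat) (u j))^4)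
                 \<le> C * (expectation (\<lambda>\<omega>. (inner (Y 1 \<omega> - yhat) (u j))^2))\<^sup>2"
begin

definition W :: "nat \<Rightarrow> nat \<Rightarrow> 'w \<Rightarrow> real" where
  "W j i \<omega> = inner (Y i \<omega> - yhat) (u j)"

definition a :: "nat \<Rightarrow> real" where
  "a j = expectation (\<lambda>\<omega>. (inner (Y 1 \<omega> - yhat) (u j))^2)"

lemma a_pos: "j \<ge> 1 \<Longrightarrow> a j > 0"
  unfolding a_def by (rule mom2)

lemma expectation_ident:
  fixes f :: "'y \<Rightarrow> real"
  assumes "f \<in> borel_measurable borel" "i \<ge> 1"
  shows "integrable M (\<lambda>\<omega>. f (Y i \<omega>)) \<longleftrightarrow> integrable M (\<lambda>\<omega>. f (Y 1 \<omega>))"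
    and "expectation (\<lambda>\<omega>. f (Y i \<omega>)) = expectation (\<lambda>\<omega>. f (Y 1 \<omega>))"
proof -
  show "integrable M (\<lambda>\<omega>. f (Y i \<omega>)) \<longleftrightarrow> integrable M (\<lambda>\<omega>. f (Y 1 \<omega>))"
    using integrable_distr_eq[OF Y_meas assms(1), of i] integrable_distr_eq[OF Y_meas assms(1), of 1]
      assms(2) Y_ident[of i] by simp
  show "expectation (\<lambda>\<omega>. f (Y i \<omega>)) = expectation (\<lambda>\<omega>. f (Y 1 \<omega>))"
    using integral_distr[OF Y_meas assms(1), of i] integral_distr[OF Y_meas assms(1), of 1]
      assms(2) Y_ident[of i] by simp
qed

lemma W_moments:
  assumes "i \<ge> 1" "j \<ge> 1"
  shows "integrable M (\<lambda>\<omega>. (W j i \<omega>)^2)" "integrable M (\<lambda>\<omega>. (W j i \<omega>)^4)"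
    "expectation (W j i) = 0" "expectation (\<lambda>\<omega>. (W j i \<omega>)^2) = a j"
    "expectation (\<lambda>\<omega>. (W j i \<omega>)^4) \<le> C * (a j)\<^sup>2"
proof -
  have m: "(\<lambda>z. inner (z - yhat) (u j)) \<in> borel_measurable borel"
    "(\<lambda>z. (inner (z - yhat) (u j))^2) \<in> borel_measurable borel"
    "(\<lambda>z. (inner (z - yhat) (u j))^4) \<in> borel_measurable borel" by measurable
  have "expectation (\<lambda>\<omega>. inner (Y 1 \<omega> - yhat) (u j)) = inner (expectation (\<lambda>\<omega>. Y 1 \<omega> - yhat)) (u j)"
    using Y_int by (intro integral_inner_left) auto
  also have "\<dots> = 0" using Y_int Y_mean prob_space by simp
  finally show "expectation (W j i) = 0"
    using expectation_ident(2)[OF m(1) assms(1)] by (simp add: W_def[abs_def])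
  show "integrable M (\<lambda>\<omega>. (W j i \<omega>)^2)" "integrable M (\<lambda>\<omega>. (W j i \<omega>)^4)"
    "expectation (\<lambda>\<omega>. (W j i \<omega>)^2) = a j" "expectation (\<lambda>\<omega>. (W j i \<omega>)^4) \<le> C * (a j)\<^sup>2"
    unfolding W_def a_def
    using expectation_ident[OF m(2) assms(1)] expectation_ident[OF m(3) assms(1)]
      int2[OF assms(2)] int4[OF assms(2)] mom4[OF assms(2)] by auto
qed

lemma W_indep: "indep_vars (\<lambda>_. borel) (W j) {1..n}"
proof -
  have "indep_vars (\<lambda>_. borel) Y {1..n}" by (rule indep_vars_subset[OF Y_indep]) auto
  then have "indep_vars (\<lambda>_. borel) (\<lambda>i \<omega>. inner (Y i \<omega> - yhat) (u j)) {1..n}"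
    by (rule indep_vars_compose2) auto
  then show ?thesis by (simp add: W_def[abs_def])
qed

lemma mean_error_eq:
  assumes "n \<ge> 1"
  shows "inner (Ybar n (\<lambda>i. Y i \<omega>) - yhat) (u j) = (\<Sum>i=1..n. W j i \<omega>) / n"
  using assms
  by (simp add: Ybar_def W_def inner_diff_left inner_sum_left sum_subtractf field_simps)

text \<open>The sample variance is invariant under shifts, so the data may be replaced by their
  centred components.\<close>

lemma mdp_s2_eq:
  assumes "n \<ge> 1"
  shows "mdp_s2 u n (\<lambda>i. Y i \<omega>) j
    = 1 / (real n - 1) * (\<Sum>i=1..n. (W j i \<omega> - (\<Sum>i=1..n. W j i \<omega>) / n)\<^sup>2)"
proof -
  have "inner (Y i \<omega> - Ybar n (\<lambda>i. Y i \<omega>)) (u j) = W j i \<omega> - (\<Sum>i=1..n. W j i \<omega>) / n" for i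
    unfolding mean_error_eq[OF assms, symmetric] by (simp add: W_def inner_diff_left)
  then show ?thesis by (simp add: mdp_s2_def)
qed

lemma mdp_s2_concentration:
  assumes "n \<ge> 2" "j \<ge> 1"
  shows "prob {\<omega> \<in> space M. \<not> (a j / 2 \<le> mdp_s2 u n (\<lambda>i. Y i \<omega>) j \<and> mdp_s2 u n (\<lambda>i. Y i \<omega>) j \<le> 3 * a j)}
    \<le> (16 * C + 8) / n"
proof -
  have n1: "n \<ge> 1" using assms(1) by simp
  show ?thesis
    unfolding mdp_s2_eq[OF n1]
    by (rule sample_variance_concentration[OF assms(1) _ W_indep])
      (use assms a_pos W_moments in auto)
qed

text \<open>Averaging \<open>n\<close> independent copies leaves the variance \<open>a j / n\<close>
  in component \<open>j\<close>. Only expectations are added over \<open>j\<close>, so correlations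
  between components are harmless.\<close>

lemma weighted_mean_error_markov:
  assumes "n \<ge> 1" "finite F" "F \<subseteq> {1..}" "\<And>j. j \<in> F \<Longrightarrow> w j \<ge> 0" "t > 0"
  shows "prob {\<omega> \<in> space M. t < (\<Sum>j\<in>F. w j * (inner (Ybar n (\<lambda>i. Y i \<omega>) - yhat) (u j))\<^sup>2)}
    \<le> (\<Sum>j\<in>F. w j * a j) / n / t"
proof (rule markov_prob)
  have m: "integrable M (\<lambda>\<omega>. (inner (Ybar n (\<lambda>i. Y i \<omega>) - yhat) (u j))\<^sup>2)"
    "expectation (\<lambda>\<omega>. (inner (Ybar n (\<lambda>i. Y i \<omega>) - yhat) (u j))\<^sup>2) = a j / n" if "j \<in> F" for j
  proof -
    have j: "j \<ge> 1" using that assms(3) by auto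
    have "integrable M (\<lambda>\<omega>. (\<Sum>i=1..n. W j i \<omega>)\<^sup>2)
      \<and> expectation (\<lambda>\<omega>. (\<Sum>i=1..n. W j i \<omega>)\<^sup>2) = (\<Sum>i=1..n. expectation (\<lambda>\<omega>. (W j i \<omega>)\<^sup>2))"
      by (rule second_moment_sum_indep[OF _ W_indep]) (use W_moments j in auto)
    moreover have "(\<Sum>i=1..n. expectation (\<lambda>\<omega>. (W j i \<omega>)\<^sup>2)) = n * a j"
      using W_moments(4) j by simp
    ultimately show "integrable M (\<lambda>\<omega>. (inner (Ybar n (\<lambda>i. Y i \<omega>) - yhat) (u j))\<^sup>2)"
      "expectation (\<lambda>\<omega>. (inner (Ybar n (\<lambda>i. Y i \<omega>) - yhat) (u j))\<^sup>2) = a j / n"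
      unfolding mean_error_eq[OF assms(1)] power_divide using assms(1)
      by (auto simp: power2_eq_square)
  qed
  show "integrable M (\<lambda>\<omega>. \<Sum>j\<in>F. w j * (inner (Ybar n (\<lambda>i. Y i \<omega>) - yhat) (u j))\<^sup>2)"
    using m by auto
  show "0 \<le> (\<Sum>j\<in>F. w j * (inner (Ybar n (\<lambda>i. Y i \<omega>) - yhat) (u j))\<^sup>2)" for \<omega>
    using assms(4) by (intro sum_nonneg) auto
  have "expectation (\<lambda>\<omega>. \<Sum>j\<in>F. w j * (inner (Ybar n (\<lambda>i. Y i \<omega>) - yhat) (u j))\<^sup>2)
      = (\<Sum>j\<in>F. w j * (a j / n))"
    using m by (subst Bochner_Integration.integral_sum) auto
  then show "expectation (\<lambda>\<omega>. \<Sum>j\<in>F. w j * (inner (Ybar n (\<lambda>i. Y i \<omega>) - yhat) (u j))\<^sup>2)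
      \<le> (\<Sum>j\<in>F. w j * a j) / n"
    by (simp add: sum_divide_distrib)
qed (use assms in auto)

section \<open>Measurability of the stopping index and of the error\<close>

lemma Ybar_measurable [measurable]: "(\<lambda>\<omega>. Ybar n (\<lambda>i. Y i \<omega>)) \<in> borel_measurable M"
  unfolding Ybar_def using Y_meas
  by (intro borel_measurable_scaleR borel_measurable_sum borel_measurable_const) auto

lemma mdp_s2_measurable [measurable]: "(\<lambda>\<omega>. mdp_s2 u n (\<lambda>i. Y i \<omega>) j) \<in> borel_measurable M"
proof -
  have [measurable]: "Y i \<in> borel_measurable M" if "i \<in> {1..n}" for i using Y_meas that by auto
  show ?thesis unfolding mdp_s2_def by measurable
qed

lemma mdp_dsq_measurable:
  "(\<lambda>\<omega>. mdp_dsq \<sigma> \<epsilon>2 (mdp_s2 u n (\<lambda>i. Y i \<omega>)) (mdp_S \<epsilon>1 u n (\<lambda>i. Y i \<omega>)) j) \<in> borel_measurable M"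
proof (induction j)
  case (Suc j)
  note [measurable] = Suc
  show ?case unfolding mdp_dsq.simps Let_def mdp_S_def
    using Suc unfolding mdp_S_def by measurable
qed simp

lemma mdp_k_measurable [measurable]:
  "(\<lambda>\<omega>. mdp_k \<epsilon>1 \<epsilon>2 \<sigma> u n (\<lambda>i. Y i \<omega>)) \<in> measurable M (count_space UNIV)"
proof -
  have [measurable]: "(\<lambda>\<omega>. mdp_d \<epsilon>1 \<epsilon>2 \<sigma> u n (\<lambda>i. Y i \<omega>) j) \<in> borel_measurable M" for j
    unfolding mdp_d_def using mdp_dsq_measurable by measurable
  show ?thesis unfolding mdp_k_def mdp_delta_def by measurable
qed

text \<open>The solution space is not assumed second countable here, so the norm is expanded into
  inner products and only real-valued functions have to be measurable.\<close>

lemma norm_Xbar_diff_measurable: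
  fixes v :: "nat \<Rightarrow> 'x::real_inner"
  shows "(\<lambda>\<omega>. norm (Xbar \<sigma> u v n (\<lambda>i. Y i \<omega>) k - xhat)) \<in> borel_measurable M"
proof -
  let ?y = "\<lambda>\<omega>. Ybar n (\<lambda>i. Y i \<omega>)" and ?X = "\<lambda>\<omega>. Xbar \<sigma> u v n (\<lambda>i. Y i \<omega>) k"
  have "(\<lambda>\<omega>. inner (?X \<omega>) z) \<in> borel_measurable M" for z
    by (simp add: Xbar_def inner_sum_left)
  moreover have "inner (?X \<omega>) (?X \<omega>) = (\<Sum>j=1..k. (inner (?y \<omega>) (u j) / \<sigma> j) * inner (?X \<omega>) (v j))" for \<omega>
    by (subst (2) Xbar_def) (simp add: inner_sum_right)
  moreover have "norm (?X \<omega> - xhat)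
      = sqrt (inner (?X \<omega>) (?X \<omega>) - 2 * inner (?X \<omega>) xhat + inner xhat xhat)" for \<omega>
    unfolding norm_eq_sqrt_inner
    by (simp add: inner_diff_left inner_diff_right inner_commute)
  ultimately show ?thesis by simp
qed

text \<open>The random index takes countably many values, so measurability for each fixed index is
  enough.\<close>

lemma mdp_error_measurable:
  fixes v :: "nat \<Rightarrow> 'x::real_inner"
  shows "{\<omega> \<in> space M. norm (Xbar \<sigma> u v n (\<lambda>i. Y i \<omega>) (mdp_k \<epsilon>1 \<epsilon>2 \<sigma> u n (\<lambda>i. Y i \<omega>)) - xhat) \<le> B} \<in> sets M"
proof -
  note [measurable] = norm_Xbar_diff_measurable
  have "(\<lambda>\<omega>. norm (Xbar \<sigma> u v n (\<lambda>i. Y i \<omega>) (mdp_k \<epsilon>1 \<epsilon>2 \<sigma> u n (\<lambda>i. Y i \<omega>)) - xhat)) \<in> borel_measurable M"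
    by (rule measurable_compose_countable[where f = "\<lambda>k \<omega>. norm (Xbar \<sigma> u v n (\<lambda>i. Y i \<omega>) k - xhat)"]) measurable
  then show ?thesis by measurable
qed

end

subsection \<open>Convergence in probability\<close>

lemma mdp_m_bounds:
  assumes "n \<ge> 1" "\<epsilon>1 < 1"
  shows "mdp_m \<epsilon>1 n \<ge> 1" "real (mdp_m \<epsilon>1 n) \<le> real n powr (1 - \<epsilon>1)"
    "real n powr (1 - \<epsilon>1) / 2 \<le> real (mdp_m \<epsilon>1 n)"
proof -
  have t: "1 \<le> real n powr (1 - \<epsilon>1)" using assms by (intro ge_one_powr_ge_zero) auto
  have m: "real (mdp_m \<epsilon>1 n) = real_of_int \<lfloor>real n powr (1 - \<epsilon>1)\<rfloor>"
    using t by (simp add: mdp_m_def)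
  have "1 \<le> \<lfloor>real n powr (1 - \<epsilon>1)\<rfloor>" using t by simp
  then have "1 \<le> real (mdp_m \<epsilon>1 n)" unfolding m by linarith
  then show "mdp_m \<epsilon>1 n \<ge> 1" by simp
  show "real (mdp_m \<epsilon>1 n) \<le> real n powr (1 - \<epsilon>1)" unfolding m by linarith
  \<comment> \<open>A real number below its floor plus 1 is at most twice its floor once the floor
    is at least 1.\<close>
  show "real n powr (1 - \<epsilon>1) / 2 \<le> real (mdp_m \<epsilon>1 n)"
    using \<open>1 \<le> real (mdp_m \<epsilon>1 n)\<close> unfolding m by linarith
qed

lemma inverse_sqrt_powr:
  assumes "n \<ge> 1"
  shows "((1 / sqrt (real n)) powr t)\<^sup>2 = real n powr (-t)"
proof -
  have "1 / sqrt (real n) = real n powr (-(1/2))"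
    using assms by (simp add: powr_minus_divide powr_half_sqrt)
  then have "(1 / sqrt (real n)) powr t = real n powr (-(t / 2))" by (simp add: powr_powr)
  then show ?thesis by (simp add: power2_eq_square flip: powr_add)
qed

text \<open>This merges the two error terms into one constant times a maximum. The prefactors
  \<open>k1\<close> and \<open>k2\<close>, later powers of \<rho>, are introduced at the price of
  dividing by the smaller one.\<close>

lemma sqrt_combination_le_max:
  fixes A1 A2 k1 k2 r s :: real
  assumes "A1 \<ge> 0" "A2 \<ge> 0" "k1 > 0" "k2 > 0" "r \<ge> 0" "s \<ge> 0"
  shows "sqrt (A1 * r\<^sup>2 + A2 * s\<^sup>2) \<le> sqrt (A1 + A2) / min k1 k2 * max (k1 * r) (k2 * s)"
proof -
  have "A1 * r\<^sup>2 + A2 * s\<^sup>2 \<le> (A1 + A2) * (max r s)\<^sup>2"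
    unfolding distrib_right using assms by (intro add_mono mult_left_mono power_mono) auto
  then have "sqrt (A1 * r\<^sup>2 + A2 * s\<^sup>2) \<le> sqrt (A1 + A2) * max r s"
    using assms real_sqrt_le_mono by (fastforce simp: real_sqrt_mult)
  also have "max r s \<le> max (k1 * r) (k2 * s) / min k1 k2"
  proof -
    have "min k1 k2 * r \<le> k1 * r" "min k1 k2 * s \<le> k2 * s"
      using assms by (auto intro: mult_right_mono)
    then have "r * min k1 k2 \<le> max (k1 * r) (k2 * s)" "s * min k1 k2 \<le> max (k1 * r) (k2 * s)"
      by (auto simp: mult.commute le_max_iff_disj)
    then show ?thesis using assms by (simp add: pos_le_divide_eq)
  qed
  finally show ?thesis using assms by (simp add: mult_left_mono)
qed

lemma sum_tail_le_suminf:
  fixes f :: "nat \<Rightarrow> real"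
  assumes "summable f" "\<And>j. f j \<ge> 0"
  shows "(\<Sum>j\<in>{J<..m}. f j) \<le> suminf f - (\<Sum>j\<le>J. f j)"
proof -
  have "(\<Sum>j\<in>{J<..m}. f j) + (\<Sum>j\<le>J. f j) = (\<Sum>j\<in>{J<..m} \<union> {..J}. f j)"
    by (rule sum.union_disjoint[symmetric]) auto
  also have "\<dots> \<le> suminf f" using assms by (intro sum_le_suminf) auto
  finally show ?thesis by simp
qed

lemma (in prob_space) prob_tendsto_1:
  assumes "\<forall>\<^sub>F n in sequentially. 1 - b n \<le> prob (T n)" "b \<longlonglongrightarrow> 0"
  shows "(\<lambda>n. prob (T n)) \<longlonglongrightarrow> 1"
proof (rule tendsto_sandwich[OF assms(1)])
  show "(\<lambda>n. 1 - b n) \<longlonglongrightarrow> 1" using tendsto_diff[OF tendsto_const assms(2), of 1] by simp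
qed auto

theorem theorem3:
  fixes K :: "'x::{real_inner,complete_space} \<Rightarrow> 'y::{real_inner,banach,second_countable_topology}"
    and \<sigma> :: "nat \<Rightarrow> real" and u :: "nat \<Rightarrow> 'y" and v :: "nat \<Rightarrow> 'x"
    and M :: "'w measure" and Y :: "nat \<Rightarrow> 'w \<Rightarrow> 'y"
    and xhat :: 'x and yhat :: 'y
    and \<epsilon>1 \<epsilon>2 p q Cp C \<nu> \<rho> :: real
  assumes K_compact: "compact_operator K"
    and K_dense: "closure (range K) = UNIV"
    and svd: "is_svd K \<sigma> u v"
    and eq: "K xhat = yhat"
    and eps1: "0 < \<epsilon>1" "\<epsilon>1 < 1"
    and prob: "prob_space M"
    and Y_meas: "\<And>i. i \<ge> 1 \<Longrightarrow> Y i \<in> borel_measurable M"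
    and Y_indep: "prob_space.indep_vars M (\<lambda>_. borel) Y {1..}"
    and Y_ident: "\<And>i. i \<ge> 1 \<Longrightarrow> distr M borel (Y i) = distr M borel (Y 1)"
    and Y_int: "integrable M (Y 1)"
    and Y_mean: "(\<integral>\<omega>. Y 1 \<omega> \<partial>M) = yhat"
    and pq: "q > p - 1" "p - 1 > 0"
    and const_pos: "Cp > 0" "C > 0"
    and sigma_rate: "\<exists>c1 c2. c1 > 0 \<and> c2 > 0 \<and>
        (\<forall>j\<ge>1. c1 * real j powr (-q) \<le> (\<sigma> j)\<^sup>2 \<and> (\<sigma> j)\<^sup>2 \<le> c2 * real j powr (-q))"
    and int2: "\<And>j. j \<ge> 1 \<Longrightarrow> integrable M (\<lambda>\<omega>. (inner (Y 1 \<omega> - yhat) (u j))^2)"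
    and int4: "\<And>j. j \<ge> 1 \<Longrightarrow> integrable M (\<lambda>\<omega>. (inner (Y 1 \<omega> - yhat) (u j))^4)"
    and mom2: "\<And>j. j \<ge> 1 \<Longrightarrow> 0 < (\<integral>\<omega>. (inner (Y 1 \<omega> - yhat) (u j))^2 \<partial>M) \<and>
                 (\<integral>\<omega>. (inner (Y 1 \<omega> - yhat) (u j))^2 \<partial>M) \<le> Cp * real j powr (-p)"
    and mom4: "\<And>j. j \<ge> 1 \<Longrightarrow> (\<integral>\<omega>. (inner (Y 1 \<omega> - yhat) (u j))^4 \<partial>M)
                 \<le> C * (\<integral>\<omega>. (inner (Y 1 \<omega> - yhat) (u j))^2 \<partial>M)\<^sup>2"
    and eps2: "0 < \<epsilon>2" "\<epsilon>2 < min 1 (p - 1)"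
    and nu_rho: "\<nu> > 0" "\<rho> > 0"
    and source: "xhat \<in> source_set \<sigma> v \<nu> \<rho>"
  shows "\<exists>L>0. (\<lambda>n. measure M {\<omega> \<in> space M.
            norm (Xbar \<sigma> u v n (\<lambda>i. Y i \<omega>) (mdp_k \<epsilon>1 \<epsilon>2 \<sigma> u n (\<lambda>i. Y i \<omega>)) - xhat)
            \<le> L * max (\<rho> powr ((q + 1 + \<epsilon>2 - p) / ((\<nu> + 1) * q + 1 + \<epsilon>2 - p))
                         * (1 / sqrt (real n)) powr (\<nu> / (\<nu> + 1 - (p - 1 - \<epsilon>2) / q)))
                      (\<rho> * (1 / sqrt (real n)) powr ((1 - \<epsilon>1) * q * \<nu>))})
         \<longlonglongrightarrow> 1"
proof -
  interpret prob_space M by (rule prob)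
  interpret N: iid_noise M Y yhat u C
    by unfold_locales
      (fact Y_meas Y_indep Y_ident Y_int Y_mean int2 int4 mom4 mom2[THEN conjunct1])+
  obtain c1 c2 where c12: "c1 > 0" "c2 > 0"
    and \<sigma>_rate: "\<And>j. j \<ge> 1 \<Longrightarrow> c1 * real j powr (-q) \<le> (\<sigma> j)\<^sup>2 \<and> (\<sigma> j)\<^sup>2 \<le> c2 * real j powr (-q)"
    using sigma_rate by blast
  obtain \<xi> where \<xi>: "norm \<xi> \<le> \<rho>"
    "((\<lambda>j. (\<sigma> j powr \<nu> * inner \<xi> (v j)) *\<^sub>R v j) has_sum xhat) {1..}"
    using source by (auto simp: source_set_def)
  define f where "f j = real j powr (-(1 + \<epsilon>2))" for j :: nat
  define Z where "Z = suminf f"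
  have f: "summable f" "\<And>j. f j \<ge> 0"
    using eps2 unfolding f_def by (auto simp: summable_real_powr_iff)
  interpret P: mdp_problem \<sigma> u v xhat \<xi> yhat N.a p q \<epsilon>1 \<epsilon>2 \<nu> \<rho> Cp c1 c2 Z
  proof
    show "inner yhat (u j) = \<sigma> j * (\<sigma> j powr \<nu> * inner \<xi> (v j))" if "j \<ge> 1" for j
      using inner_svd_image[OF bounded_linear_compact_operator[OF K_compact] svd \<xi>(2) that] eq by simp
    show "N.a j \<le> Cp * real j powr (-p)" if "j \<ge> 1" for j
      using mom2[OF that] by (simp add: N.a_def)
    show "(\<Sum>j=1..n. real j powr (-(1 + \<epsilon>2))) \<le> Z" for n
      unfolding Z_def f_def[symmetric] using f by (intro sum_le_suminf) auto
  qed (use svd \<xi> \<sigma>_rate N.a_pos const_pos c12 nu_rho pq eps2 in \<open>auto simp: is_svd_def\<close>)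
  \<comment> \<open>This \<tau> meets two demands: \<open>\<tau> * (q + 1)\<close> is half of 1 -
    \<alpha>, so the amplified noise up to \<open>J n\<close> is negligible against the squared
    rate, and \<tau> * \<theta> \<le> 1 - \<alpha> because \<theta> \<le> 2 * (q + 1).\<close>
  define \<tau> where "\<tau> = (1 - P.\<alpha>) / (2 * (q + 1))"
  define J where "J n = nat \<lfloor>real n powr \<tau>\<rfloor>" for n :: nat
  define m where "m = mdp_m \<epsilon>1"
  define \<eta> where "\<eta> = P.c0 / (24 * Cp * Z)"
  let ?y = "\<lambda>\<omega> i. Y i \<omega>"
  let ?e = "\<lambda>n \<omega> j. inner (Ybar n (\<lambda>i. Y i \<omega>) - yhat) (u j)"
  have q: "q > 0" using pq by simp
  have \<alpha>1: "P.\<alpha> < 1" by (rule P.\<alpha>_less_1)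
  have \<tau>_pos: "\<tau> > 0" using \<alpha>1 q by (simp add: \<tau>_def)
  have \<eta>_pos: "\<eta> > 0" using P.c0_pos P.Z_ge_1 const_pos by (simp add: \<eta>_def)
  have J_le: "real (J n) \<le> real n powr \<tau>" for n by (simp add: J_def)

  define A1 where "A1 = 3 + (4 * P.C0 + 2 * P.c0) / P.c + 2 * P.G * \<rho>\<^sup>2"
  \<comment> \<open>The factor \<open>2 powr P.\<beta>\<close> pays for the rounding in
    \<open>m n\<close>, which is at least half of \<open>n powr (1 - \<epsilon>1)\<close>.\<close>
  define A2 where "A2 = P.G * \<rho>\<^sup>2 * 2 powr P.\<beta>"
  define k1 where "k1 = \<rho> powr ((q + 1 + \<epsilon>2 - p) / ((\<nu> + 1) * q + 1 + \<epsilon>2 - p))"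
  define L where "L = sqrt (A1 + A2) / min k1 \<rho>"
  have A1: "A1 > 0"
    unfolding A1_def using P.c_pos P.c0_pos const_pos
    by (intro add_pos_nonneg divide_nonneg_pos) (auto simp: P.C0_def P.G_def)
  have A2: "A2 \<ge> 0" by (simp add: A2_def P.G_def)
  have k1: "k1 > 0" using nu_rho by (simp add: k1_def)
  have L: "L > 0" using A1 A2 k1 nu_rho by (simp add: L_def)
  \<comment> \<open>Expanding the fraction by \<open>q\<close> turns the exponent of the claim into
    \<beta> / (\<beta> + \<theta>).\<close>
  have \<alpha>: "\<nu> / (\<nu> + 1 - (p - 1 - \<epsilon>2) / q) = P.\<alpha>"
    using q by (simp add: P.\<alpha>_def P.\<beta>_def P.\<theta>_def field_simps)

  define T where "T n = {\<omega> \<in> space M.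
      norm (Xbar \<sigma> u v n (?y \<omega>) (mdp_k \<epsilon>1 \<epsilon>2 \<sigma> u n (?y \<omega>)) - xhat)
      \<le> L * max (k1 * (1 / sqrt (real n)) powr P.\<alpha>) (\<rho> * (1 / sqrt (real n)) powr ((1 - \<epsilon>1) * q * \<nu>))}" for n
  define B1 where "B1 n = (\<Union>j\<in>{1..m n}. {\<omega> \<in> space M. \<not> (N.a j / 2 \<le> mdp_s2 u n (?y \<omega>) j \<and>
      mdp_s2 u n (?y \<omega>) j \<le> 3 * N.a j)})" for n
  define B2 where "B2 n = {\<omega> \<in> space M. \<eta> / n < (\<Sum>j\<in>{J n<..m n}. f j / N.a j * (?e n \<omega> j)\<^sup>2)}" for n
  define B3 where "B3 n = {\<omega> \<in> space M. real n powr (-P.\<alpha>) < (\<Sum>j=1..J n. 1 / (\<sigma> j)\<^sup>2 * (?e n \<omega> j)\<^sup>2)}" for n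
  \<comment> \<open>The three summands bound the probabilities of \<open>B1\<close>,
    \<open>B2\<close> and \<open>B3\<close>, in this order.\<close>
  define b where "b n = (16 * C + 8) * real n powr (-\<epsilon>1) + (Z - (\<Sum>j\<le>J n. f j)) / \<eta>
      + Cp / c1 * real n powr (-((1 - P.\<alpha>) / 2))" for n
  have [measurable]: "B1 n \<in> sets M" "B2 n \<in> sets M" "B3 n \<in> sets M" for n
    unfolding B1_def B2_def B3_def by measurable
  have T_meas: "T n \<in> sets M" for n unfolding T_def by (rule N.mdp_error_measurable)

  \<comment> \<open>There are at most \<open>n powr (1 - \<epsilon>1)\<close> events, each of
    probability of order \<open>1 / n\<close>; the sum vanishes because \<epsilon>1 > 0.\<close>
  have prob_B1: "prob (B1 n) \<le> (16 * C + 8) * real n powr (-\<epsilon>1)" if n: "n \<ge> 2" for n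
  proof -
    have "prob (B1 n) \<le> (\<Sum>j\<in>{1..m n}. prob {\<omega> \<in> space M. \<not> (N.a j / 2 \<le> mdp_s2 u n (?y \<omega>) j \<and>
      mdp_s2 u n (?y \<omega>) j \<le> 3 * N.a j)})"
      unfolding B1_def by (intro measure_UNION_le) auto
    also have "\<dots> \<le> (\<Sum>j\<in>{1..m n}. (16 * C + 8) / n)"
      using n by (intro sum_mono N.mdp_s2_concentration) auto
    also have "\<dots> = (16 * C + 8) / n * real (m n)" by simp
    also have "\<dots> \<le> (16 * C + 8) / n * real n powr (1 - \<epsilon>1)"
      using mdp_m_bounds(2)[of n \<epsilon>1] n eps1 const_pos unfolding m_def by (intro mult_left_mono) auto
    also have "\<dots> = (16 * C + 8) * real n powr (-\<epsilon>1)"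
      using n by (simp add: powr_diff powr_minus field_simps)
    finally show ?thesis .
  qed
  \<comment> \<open>Dividing the weights by \<open>N.a j\<close> leaves expectations
    \<open>f j / n\<close>. The \<open>1 / n\<close> cancels against the threshold, and what remains
    is the tail of a convergent series, which is small because \<open>J n\<close> tends to
    infinity.\<close>
  have prob_B2: "prob (B2 n) \<le> (Z - (\<Sum>j\<le>J n. f j)) / \<eta>" if n: "n \<ge> 2" for n
  proof -
    have "prob (B2 n) \<le> (\<Sum>j\<in>{J n<..m n}. f j / N.a j * N.a j) / n / (\<eta> / n)"
      unfolding B2_def using n \<eta>_pos f N.a_pos
      by (intro N.weighted_mean_error_markov) (auto intro!: divide_nonneg_pos)
    also have "(\<Sum>j\<in>{J n<..m n}. f j / N.a j * N.a j) = (\<Sum>j\<in>{J n<..m n}. f j)"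
      using N.a_pos by (intro sum.cong) (auto simp: less_imp_neq[symmetric])
    also have "(\<Sum>j\<in>{J n<..m n}. f j) / n / (\<eta> / n) = (\<Sum>j\<in>{J n<..m n}. f j) / \<eta>"
      using n by simp
    also have "\<dots> \<le> (Z - (\<Sum>j\<le>J n. f j)) / \<eta>"
      unfolding Z_def using sum_tail_le_suminf[OF f] \<eta>_pos by (intro divide_right_mono) auto
    finally show ?thesis .
  qed
  \<comment> \<open>A crude bound is enough: the decay of \<open>j powr (-p)\<close> is discarded
    and each of the \<open>J n\<close> summands is at most \<open>Cp / c1\<close> times
    \<open>n powr (\<tau> * q)\<close>. The exponents add up to (1 - \<alpha>) / 2 - 1 + \<alpha> =
    -(1 - \<alpha>) / 2.\<close>
  have prob_B3: "prob (B3 n) \<le> Cp / c1 * real n powr (-((1 - P.\<alpha>) / 2))" if n: "n \<ge> 2" for n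
  proof -
    have "prob (B3 n) \<le> (\<Sum>j=1..J n. 1 / (\<sigma> j)\<^sup>2 * N.a j) / n / real n powr (-P.\<alpha>)"
      unfolding B3_def using n by (intro N.weighted_mean_error_markov) auto
    also have "(\<Sum>j=1..J n. 1 / (\<sigma> j)\<^sup>2 * N.a j) \<le> (\<Sum>j=1..J n. Cp / c1 * (real n powr \<tau>) powr q)"
    proof (rule sum_mono)
      fix j assume "j \<in> {1..J n}"
      then have j: "1 \<le> j" "real j \<le> real n powr \<tau>" using J_le[of n] by auto
      have jp: "real j powr (-p) \<le> 1" using powr_mono[of "-p" 0 "real j"] j pq by simp
      have "1 / (\<sigma> j)\<^sup>2 * N.a j \<le> 1 / (c1 * real j powr (-q)) * (Cp * real j powr (-p))"
        using P.\<sigma>_lower[OF j(1)] P.a_upper[OF j(1)] c12 j N.a_pos[OF j(1)] by (intro mult_mono frac_le) auto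
      also have "\<dots> = Cp / c1 * (real j powr q * real j powr (-p))"
        using c12 by (simp add: powr_minus field_simps)
      also have "\<dots> \<le> Cp / c1 * ((real n powr \<tau>) powr q * 1)"
        using jp j q const_pos c12 by (intro mult_left_mono mult_mono powr_mono2) auto
      finally show "1 / (\<sigma> j)\<^sup>2 * N.a j \<le> Cp / c1 * (real n powr \<tau>) powr q" by simp
    qed
    also have "\<dots> = real (J n) * (Cp / c1 * (real n powr \<tau>) powr q)" by simp
    also have "\<dots> \<le> real n powr \<tau> * (Cp / c1 * (real n powr \<tau>) powr q)"
      using J_le const_pos c12 by (intro mult_right_mono) auto
    also have "\<dots> = Cp / c1 * real n powr (\<tau> * (q + 1))"
      by (simp add: powr_powr distrib_left powr_add)
    also have "\<tau> * (q + 1) = (1 - P.\<alpha>) / 2" using q by (simp add: \<tau>_def field_simps)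
    also have "Cp / c1 * real n powr ((1 - P.\<alpha>) / 2) / n / real n powr (-P.\<alpha>)
        = Cp / c1 * (real n powr ((1 - P.\<alpha>) / 2) / real n powr 1 / real n powr (-P.\<alpha>))"
      using n by simp
    also have "real n powr ((1 - P.\<alpha>) / 2) / real n powr 1 / real n powr (-P.\<alpha>)
        = real n powr ((1 - P.\<alpha>) / 2 - 1 - (-P.\<alpha>))"
      unfolding powr_diff ..
    also have "(1 - P.\<alpha>) / 2 - 1 - (-P.\<alpha>) = -((1 - P.\<alpha>) / 2)" by (simp add: field_simps)
    finally show ?thesis using n by (simp add: divide_right_mono)
  qed

  have good: "space M - (B1 n \<union> B2 n \<union> B3 n) \<subseteq> T n" if n: "n \<ge> 2" for n
  proof
    fix \<omega> assume \<omega>: "\<omega> \<in> space M - (B1 n \<union> B2 n \<union> B3 n)"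
    have n1: "n \<ge> 1" using n by simp
    have "real (J n) powr P.\<theta> \<le> (real n powr \<tau>) powr P.\<theta>"
      using J_le P.\<theta>_pos by (intro powr_mono2) auto
    also have "\<dots> = real n powr (\<tau> * P.\<theta>)" by (simp add: powr_powr)
    also have "\<dots> \<le> real n powr (1 - P.\<alpha>)"
    proof (rule powr_mono)
      have "P.\<theta> \<le> 2 * (q + 1)" using eps2 q by (simp add: P.\<theta>_def)
      then have "\<tau> * P.\<theta> \<le> \<tau> * (2 * (q + 1))" using \<tau>_pos by (intro mult_left_mono) auto
      also have "\<dots> = 1 - P.\<alpha>" using q by (simp add: \<tau>_def field_simps)
      finally show "\<tau> * P.\<theta> \<le> 1 - P.\<alpha>" .
    qed (use n in auto)
    finally have J: "real (J n) powr P.\<theta> \<le> real n powr (1 - P.\<alpha>)" .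
    have "norm (Xbar \<sigma> u v n (?y \<omega>) (mdp_k \<epsilon>1 \<epsilon>2 \<sigma> u n (?y \<omega>)) - xhat)
        \<le> sqrt (A1 * real n powr (-P.\<alpha>) + P.G * \<rho>\<^sup>2 * real (m n) powr (-P.\<beta>))"
      unfolding A1_def m_def
    proof (rule P.mdp_error_bound[OF n1 _ _ _ _ J])
      show "mdp_m \<epsilon>1 n \<ge> 1" using mdp_m_bounds(1) n1 eps1 by simp
      show "N.a j / 2 \<le> mdp_s2 u n (?y \<omega>) j \<and> mdp_s2 u n (?y \<omega>) j \<le> 3 * N.a j"
        if "1 \<le> j" "j \<le> mdp_m \<epsilon>1 n" for j
        using \<omega> that unfolding B1_def m_def by auto
    qed (use \<omega> in \<open>auto simp: B2_def B3_def \<eta>_def f_def m_def\<close>)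
    also have "\<dots> \<le> sqrt (A1 * ((1 / sqrt (real n)) powr P.\<alpha>)\<^sup>2
        + A2 * ((1 / sqrt (real n)) powr ((1 - \<epsilon>1) * q * \<nu>))\<^sup>2)"
    proof (rule real_sqrt_le_mono)
      have "real (m n) powr (-P.\<beta>) \<le> (real n powr (1 - \<epsilon>1) / 2) powr (-P.\<beta>)"
        using mdp_m_bounds(3)[OF n1 eps1(2)] n P.\<beta>_pos unfolding m_def by (intro powr_mono2') auto
      also have "\<dots> = 2 powr P.\<beta> * (real n powr (1 - \<epsilon>1)) powr (-P.\<beta>)"
        by (simp add: powr_divide powr_minus field_simps del: powr_powr)
      also have "(real n powr (1 - \<epsilon>1)) powr (-P.\<beta>) = real n powr (-((1 - \<epsilon>1) * q * \<nu>))"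
        unfolding powr_powr P.\<beta>_def by (simp add: mult.assoc)
      finally have "P.G * \<rho>\<^sup>2 * real (m n) powr (-P.\<beta>)
          \<le> P.G * \<rho>\<^sup>2 * (2 powr P.\<beta> * real n powr (-((1 - \<epsilon>1) * q * \<nu>)))"
        by (intro mult_left_mono) (auto simp: P.G_def)
      then show "A1 * real n powr (-P.\<alpha>) + P.G * \<rho>\<^sup>2 * real (m n) powr (-P.\<beta>)
          \<le> A1 * ((1 / sqrt (real n)) powr P.\<alpha>)\<^sup>2 + A2 * ((1 / sqrt (real n)) powr ((1 - \<epsilon>1) * q * \<nu>))\<^sup>2"
        unfolding inverse_sqrt_powr[OF n1] A2_def by (simp add: mult_ac)
    qed
    also have "\<dots> \<le> L * max (k1 * (1 / sqrt (real n)) powr P.\<alpha>) (\<rho> * (1 / sqrt (real n)) powr ((1 - \<epsilon>1) * q * \<nu>))"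
      unfolding L_def using A1 A2 k1 nu_rho by (intro sqrt_combination_le_max) auto
    finally show "\<omega> \<in> T n" using \<omega> by (simp add: T_def)
  qed

  have "(\<lambda>n. prob (T n)) \<longlonglongrightarrow> 1"
  proof (rule prob_tendsto_1)
    show "\<forall>\<^sub>F n in sequentially. 1 - b n \<le> prob (T n)"
    proof (rule eventually_sequentiallyI[of 2])
      fix n :: nat assume n: "n \<ge> 2"
      have "prob (B1 n \<union> B2 n \<union> B3 n) \<le> prob (B1 n \<union> B2 n) + prob (B3 n)"
        by (intro measure_Un_le) auto
      also have "prob (B1 n \<union> B2 n) \<le> prob (B1 n) + prob (B2 n)"
        by (intro measure_Un_le) auto
      finally have "prob (B1 n \<union> B2 n \<union> B3 n) \<le> b n"
        using prob_B1[OF n] prob_B2[OF n] prob_B3[OF n] unfolding b_def by linarith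
      moreover have "prob (space M - (B1 n \<union> B2 n \<union> B3 n)) = 1 - prob (B1 n \<union> B2 n \<union> B3 n)"
        by (intro prob_compl) auto
      moreover have "prob (space M - (B1 n \<union> B2 n \<union> B3 n)) \<le> prob (T n)"
        using good[OF n] T_meas by (intro finite_measure_mono) auto
      ultimately show "1 - b n \<le> prob (T n)" by linarith
    qed
    have J_lim: "filterlim J at_top sequentially"
    proof -
      have "filterlim (\<lambda>n. real n powr \<tau>) at_top sequentially"
        using \<tau>_pos by real_asymp
      then have "filterlim (\<lambda>n. \<lfloor>real n powr \<tau>\<rfloor>) at_top sequentially"
        by (rule filterlim_compose[OF filterlim_floor_sequentially])
      then show ?thesis
        unfolding J_def by (rule filterlim_compose[OF filterlim_nat_sequentially])
    qed
    have "(\<lambda>N. \<Sum>j\<le>N. f j) \<longlonglongrightarrow> Z"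
      unfolding Z_def by (rule summable_LIMSEQ'[OF f(1)])
    then have "(\<lambda>n. \<Sum>j\<le>J n. f j) \<longlonglongrightarrow> Z" using J_lim by (rule filterlim_compose)
    then have "(\<lambda>n. (Z - (\<Sum>j\<le>J n. f j)) / \<eta>) \<longlonglongrightarrow> (Z - Z) / \<eta>"
      using \<eta>_pos by (intro tendsto_intros) auto
    moreover have "(\<lambda>n. (16 * C + 8) * real n powr (-\<epsilon>1)) \<longlonglongrightarrow> (16 * C + 8) * 0"
      using eps1 by (intro tendsto_mult tendsto_const) real_asymp
    moreover have "(\<lambda>n. Cp / c1 * real n powr (-((1 - P.\<alpha>) / 2))) \<longlonglongrightarrow> Cp / c1 * 0"
    proof (intro tendsto_mult tendsto_const)
      show "(\<lambda>n. real n powr (-((1 - P.\<alpha>) / 2))) \<longlonglongrightarrow> 0"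
        using \<alpha>1 by (intro tendsto_neg_powr filterlim_real_sequentially) simp
    qed
    ultimately have "b \<longlonglongrightarrow> (16 * C + 8) * 0 + (Z - Z) / \<eta> + Cp / c1 * 0"
      unfolding b_def[abs_def] by (intro tendsto_add)
    then show "b \<longlonglongrightarrow> 0" by simp
  qed
  then show ?thesis
    unfolding T_def k1_def \<alpha>[symmetric] using L by blast
qed

end
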